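(* Let $\gamma>0$, let $X_1,X_2,\ldots$ be independent exponential random variables with mean $1$, and put $\beta_n=\log(n/\gamma)-\log\log(n)$. The point process $\hat\xi_n$ on $(-\infty,\infty]^2$ consisting of the points $$\Big(\frac{i^\gamma X_i}{n^\gamma}-\beta_n,\ \frac{n-i}{n}\log n\Big),\qquad i=1,2,\ldots$$ converges in distribution as $n\to\infty$ to the Poisson point process $\hat\xi$ with mean measure $$\hat\mu(\mathrm dx,\mathrm dz)=e^{-x}\,\mathrm dx\times\gamma e^{-\gamma z}\,\mathrm dz .$$
   Context: The measure $\hat\mu$ is carried by $\mathbb R^2$. The space $(-\infty,\infty]^2$ is the Euclidean plane compactified at $+\infty$ in each coordinate, so that the sets $[x,\infty]\times[z,\infty]$, $x,z\in\mathbb R$, are compact. Convergence in distribution of point processes is with respect to the vague topology on the space of Radon measures on $(-\infty,\infty]^2$. *)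

theory Defs
  imports "HOL-Probability.Probability"
begin

section \<open>Radon measures and the vague topology\<close>

definition borel_of_top :: "'a topology \<Rightarrow> 'a measure" where
  "borel_of_top T = sigma (topspace T) {U. openin T U}"

text \<open>
  Radon measures are the Borel measures that are finite on compact sets. This is meant for locally
  compact, second countable Hausdorff spaces, where all such measures are automatically regular.
\<close>

definition radon_measures :: "'a topology \<Rightarrow> 'a measure set" where
  "radon_measures T =
     {\<mu>. sets \<mu> = sets (borel_of_top T) \<and> (\<forall>K. compactin T K \<longrightarrow> emeasure \<mu> K < \<infinity>)}"

definition cont_compact_support :: "'a topology \<Rightarrow> ('a \<Rightarrow> real) set" where
  "cont_compact_support T =
     {f. continuous_map T euclideanreal f \<and>
         (\<exists>K. compactin T K \<and> (\<forall>x \<in> topspace T - K. f x = 0))}"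

definition vague_topology :: "'a topology \<Rightarrow> 'a measure topology" where
  "vague_topology T = topology_generated_by
     {{\<mu> \<in> radon_measures T. (\<integral>x. f x \<partial>\<mu>) \<in> U} | f U. f \<in> cont_compact_support T \<and> open U}"

section \<open>Random elements of a topological space\<close>

definition random_element :: "'w measure \<Rightarrow> 'a topology \<Rightarrow> ('w \<Rightarrow> 'a) \<Rightarrow> bool" where
  "random_element M T X \<longleftrightarrow> X \<in> measurable M (borel_of_top T)"

text \<open>
  Only eventually must the approximating maps be random elements: finitely many terms of the
  sequence may be ill-defined.
\<close>

definition converges_in_distribution ::
    "'a topology \<Rightarrow> 'w measure \<Rightarrow> (nat \<Rightarrow> 'w \<Rightarrow> 'a) \<Rightarrow> 'v measure \<Rightarrow> ('v \<Rightarrow> 'a) \<Rightarrow> bool" where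
  "converges_in_distribution T M X N Y \<longleftrightarrow>
     (\<forall>\<^sub>F n in sequentially. random_element M T (X n)) \<and> random_element N T Y \<and>
     (\<forall>F. continuous_map T euclideanreal F \<and> bounded (F ` topspace T) \<longrightarrow>
        (\<lambda>n. \<integral>\<omega>. F (X n \<omega>) \<partial>M) \<longlonglongrightarrow> (\<integral>\<omega>. F (Y \<omega>) \<partial>N))"

section \<open>Point processes\<close>

text \<open>The sum of the unit masses at \<open>p i\<close>, \<open>i \<in> I\<close>, counted with multiplicity.\<close>

definition point_measure_of :: "'a topology \<Rightarrow> 'i set \<Rightarrow> ('i \<Rightarrow> 'a) \<Rightarrow> 'a measure" where
  "point_measure_of T I p = distr (count_space I) (borel_of_top T) p"

definition poisson_point_process ::
    "'a topology \<Rightarrow> 'a measure \<Rightarrow> 'w measure \<Rightarrow> ('w \<Rightarrow> 'a measure) \<Rightarrow> bool" where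
  "poisson_point_process T \<mu> M \<xi> \<longleftrightarrow>
     random_element M (vague_topology T) \<xi> \<and>
     (\<forall>B \<in> sets (borel_of_top T).
        (emeasure \<mu> B < \<infinity> \<longrightarrow>
          (\<forall>k::nat. measure M {\<omega> \<in> space M. emeasure (\<xi> \<omega>) B = of_nat k} =
             exp (- measure \<mu> B) * measure \<mu> B ^ k / fact k)) \<and>
        (emeasure \<mu> B = \<infinity> \<longrightarrow> (AE \<omega> in M. emeasure (\<xi> \<omega>) B = \<infinity>))) \<and>
     (\<forall>(m::nat) B. (\<forall>j<m. B j \<in> sets (borel_of_top T)) \<and> disjoint_family_on B {..<m} \<longrightarrow>
        prob_space.indep_vars M (\<lambda>_. borel) (\<lambda>j \<omega>. emeasure (\<xi> \<omega>) (B j)) {..<m})"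

section \<open>The processes on the plane compactified at plus infinity\<close>

definition upper_plane :: "(ereal \<times> ereal) topology" where
  "upper_plane = top_of_set ({- \<infinity> <..} \<times> {- \<infinity> <..})"

definition beta :: "real \<Rightarrow> nat \<Rightarrow> real" where
  "beta \<gamma> n = ln (real n / \<gamma>) - ln (ln (real n))"

definition xi_hat ::
    "real \<Rightarrow> (nat \<Rightarrow> 'w \<Rightarrow> real) \<Rightarrow> nat \<Rightarrow> 'w \<Rightarrow> (ereal \<times> ereal) measure" where
  "xi_hat \<gamma> X n \<omega> = point_measure_of upper_plane {1::nat..}
     (\<lambda>i. (ereal (real i powr \<gamma> * X i \<omega> / real n powr \<gamma> - beta \<gamma> n),
           ereal ((real n - real i) / real n * ln (real n))))"

definition mu_hat :: "real \<Rightarrow> (ereal \<times> ereal) measure" where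
  "mu_hat \<gamma> = distr
     (density lborel (\<lambda>x::real. ennreal (exp (- x))) \<Otimes>\<^sub>M
      density lborel (\<lambda>z::real. ennreal (\<gamma> * exp (- \<gamma> * z))))
     (borel_of_top upper_plane) (\<lambda>(x, z). (ereal x, ereal z))"

end

theory Submission
  imports Defs "HOL-Real_Asymp.Real_Asymp"
begin

text \<open>
  The proof is a coupling on the probability space of the limit \<open>\<xi>\<close>. The ordinates
  \<open>(n - i) / n * ln n\<close> of the approximating process are deterministic and cut the plane into thin
  horizontal strips, each assigned to one index. Let \<open>G\<close> be the largest abscissa of a point of
  \<open>\<xi>\<close> in such a strip, and let \<open>w\<close> be the mass of the strip under \<open>\<gamma> * exp (- \<gamma> * z) dz\<close>. The
  event \<open>G \<le> t\<close> says that a set of mean mass \<open>w * exp (- t)\<close> contains no point, so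
  \<open>P(G \<le> t) = exp (- w * exp (- t))\<close>, and \<open>Y = - ln (1 - exp (- w * exp (- G)))\<close> is a standard
  exponential variable. Disjoint strips give independent variables. The process built from these
  \<open>Y\<close> therefore has the law of the process built from the \<open>X i\<close>; only this equality of laws of
  sequences is used, because the process is a continuous function of the sequence
  (\<open>continuous_map_process_of\<close>).

  It remains to see that the coupled process converges vaguely to \<open>\<xi>\<close> almost surely, for then
  bounded convergence gives convergence in distribution without any tightness argument and without
  determining the law of \<open>\<xi>\<close> on the space of measures. Almost surely, \<open>\<xi>\<close> restricted to a quadrant
  \<open>(- a, \<infinity>] \<times> (- a, \<infinity>]\<close> consists of finitely many unit masses with distinct ordinates
  (\<open>AE_simple\<close>). When \<open>n\<close> is large these lie in distinct strips. Each of them is then the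
  maximum of its strip, and its abscissa is moved by an amount that tends to 0
  (\<open>coupled_abscissa_tendsto\<close>); this is where the norming \<open>beta \<gamma> n\<close> enters. No other strip
  contributes to a test function, because the change of variables cannot lift a maximum from below
  a fixed level into its support (\<open>coupled_abscissa_lower_bound\<close>, with
  \<open>process_of_strip_max_converges\<close> collecting the deterministic part of the argument).
\<close>

section \<open>Vague convergence and the compactified plane\<close>

lemma topspace_vague_topology [simp]: "topspace (vague_topology T) = radon_measures T"
proof -
  have "(\<lambda>_. 0) \<in> cont_compact_support T"
    by (auto simp: cont_compact_support_def intro!: exI[of _ "{}"])
  hence "radon_measures T \<in>
      {{\<mu> \<in> radon_measures T. (\<integral>x. f x \<partial>\<mu>) \<in> U} | f U. f \<in> cont_compact_support T \<and> open U}"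
    by (auto intro!: exI[of _ "\<lambda>_. 0"] exI[of _ UNIV])
  thus ?thesis
    unfolding vague_topology_def topology_generated_by_topspace by auto
qed

lemma limitin_vague_topologyI:
  assumes \<mu>: "\<mu> \<in> radon_measures T"
    and \<mu>s: "\<forall>\<^sub>F n in F. \<mu>s n \<in> radon_measures T"
    and lim: "\<And>f. f \<in> cont_compact_support T \<Longrightarrow>
      ((\<lambda>n. \<integral>x. f x \<partial>\<mu>s n) \<longlongrightarrow> (\<integral>x. f x \<partial>\<mu>)) F"
  shows "limitin (vague_topology T) \<mu>s \<mu> F"
  unfolding limitin_def
proof (intro conjI allI impI)
  show "\<mu> \<in> topspace (vague_topology T)"
    using \<mu> by simp
next
  fix U assume U: "openin (vague_topology T) U \<and> \<mu> \<in> U"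
  define S where "S = {{\<mu> \<in> radon_measures T. (\<integral>x. f x \<partial>\<mu>) \<in> U} | f U.
    f \<in> cont_compact_support T \<and> open U}"
  from U have "generate_topology_on S U"
    by (simp add: vague_topology_def openin_topology_generated_by_iff S_def)
  hence "\<mu> \<in> U \<longrightarrow> (\<forall>\<^sub>F n in F. \<mu>s n \<in> U)"
  proof induction
    case (Int a b)
    thus ?case by (auto elim: eventually_elim2)
  next
    case (UN K)
    show ?case
    proof
      assume "\<mu> \<in> \<Union> K"
      then obtain k where k: "k \<in> K" "\<mu> \<in> k" by blast
      with UN.IH have "\<forall>\<^sub>F n in F. \<mu>s n \<in> k" by blast
      thus "\<forall>\<^sub>F n in F. \<mu>s n \<in> \<Union> K"
        by (rule eventually_mono) (use k in blast)
    qed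
  next
    case (Basis s)
    then obtain f V where s: "s = {\<mu> \<in> radon_measures T. (\<integral>x. f x \<partial>\<mu>) \<in> V}"
      "f \<in> cont_compact_support T" "open V"
      by (auto simp: S_def)
    show ?case
    proof
      assume "\<mu> \<in> s"
      hence "\<forall>\<^sub>F n in F. (\<integral>x. f x \<partial>\<mu>s n) \<in> V"
        using lim[OF s(2)] s by (auto simp: tendsto_def)
      with \<mu>s show "\<forall>\<^sub>F n in F. \<mu>s n \<in> s"
        by eventually_elim (simp add: s)
    qed
  qed auto
  with U show "\<forall>\<^sub>F n in F. \<mu>s n \<in> U" by blast
qed

lemma space_borel_of_top [simp]: "space (borel_of_top T) = topspace T"
  unfolding borel_of_top_def by (rule space_measure_of) (auto dest: openin_subset)

lemma sets_borel_of_top: "sets (borel_of_top T) = sigma_sets (topspace T) {U. openin T U}"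
  unfolding borel_of_top_def by (rule sets_measure_of) (auto dest: openin_subset)

lemma openin_in_borel_of_top: "openin T U \<Longrightarrow> U \<in> sets (borel_of_top T)"
  by (simp add: sets_borel_of_top)

lemma borel_measurable_of_continuous_map:
  fixes f :: "'a \<Rightarrow> 'b :: topological_space"
  assumes "continuous_map T euclidean f"
  shows "f \<in> borel_measurable (borel_of_top T)"
proof (rule borel_measurableI)
  fix S :: "'b set" assume "open S"
  hence "openin T {x \<in> topspace T. f x \<in> S}"
    using assms by (auto simp: continuous_map_def)
  moreover have "f -` S \<inter> space (borel_of_top T) = {x \<in> topspace T. f x \<in> S}"
    by auto
  ultimately show "f -` S \<inter> space (borel_of_top T) \<in> sets (borel_of_top T)"
    by (simp add: openin_in_borel_of_top)
qed

lemma topspace_upper_plane: "topspace upper_plane = {- \<infinity> <..} \<times> {- \<infinity> <..}"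
  by (simp add: upper_plane_def)

lemma open_upper_plane: "open ({- \<infinity> <..} \<times> {- \<infinity> <..} :: (ereal \<times> ereal) set)"
  by (intro open_Times) auto

lemma sets_upper_planeI:
  assumes "B \<in> sets borel" "B \<subseteq> {- \<infinity> <..} \<times> {- \<infinity> <..}"
  shows "B \<in> sets (borel_of_top upper_plane)"
proof -
  have id: "(\<lambda>x. x) \<in> borel_measurable (borel_of_top upper_plane)"
    by (rule borel_measurable_of_continuous_map) (auto simp: upper_plane_def)
  have "(\<lambda>x. x) -` B \<inter> space (borel_of_top upper_plane) \<in> sets (borel_of_top upper_plane)"
    by (rule measurable_sets[OF id assms(1)])
  moreover have "(\<lambda>x. x) -` B \<inter> space (borel_of_top upper_plane) = B"
    using assms(2) by (auto simp: topspace_upper_plane)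
  ultimately show ?thesis by simp
qed

text \<open>
  A compact subset of the half-open compactification stays away from \<open>- \<infinity>\<close> in both coordinates;
  this is all that compactness is needed for.
\<close>

lemma compactin_upper_plane_bounded_below:
  assumes "compactin upper_plane K"
  obtains c :: real where "K \<subseteq> {ereal c..} \<times> {ereal c..}"
proof (cases "K = {}")
  case True
  thus thesis using that by blast
next
  case False
  from assms have K: "compact K" "K \<subseteq> {- \<infinity> <..} \<times> {- \<infinity> <..}"
    by (auto simp: upper_plane_def compactin_subtopology)
  have "compact (fst ` K)" "compact (snd ` K)"
    by (auto intro!: compact_continuous_image continuous_intros K)
  moreover have "fst ` K \<noteq> {}" "snd ` K \<noteq> {}"
    using False by auto
  ultimately obtain a b where a: "a \<in> fst ` K" "\<And>x. x \<in> fst ` K \<Longrightarrow> a \<le> x"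
    and b: "b \<in> snd ` K" "\<And>x. x \<in> snd ` K \<Longrightarrow> b \<le> x"
    by (meson compact_attains_inf)
  have "- \<infinity> < min a b"
    using a(1) b(1) K(2) by auto
  then obtain c where c: "ereal c < min a b"
    using ereal_dense2 by blast
  have "K \<subseteq> {ereal c..} \<times> {ereal c..}"
  proof
    fix p assume "p \<in> K"
    hence "a \<le> fst p" "b \<le> snd p" using a b by auto
    thus "p \<in> {ereal c..} \<times> {ereal c..}"
      using c by (cases p) (auto simp: min_def split: if_splits)
  qed
  thus thesis by (rule that)
qed

lemma cont_compact_support_upper_plane:
  assumes "f \<in> cont_compact_support upper_plane"
  obtains c :: real where
    "continuous_map upper_plane euclideanreal f"
    "\<And>x z. - \<infinity> < x \<Longrightarrow> - \<infinity> < z \<Longrightarrow> f (x, z) \<noteq> 0 \<Longrightarrow> ereal c \<le> x \<and> ereal c \<le> z"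
proof -
  from assms obtain K where K: "compactin upper_plane K"
    "\<forall>x \<in> topspace upper_plane - K. f x = 0" and f: "continuous_map upper_plane euclideanreal f"
    by (auto simp: cont_compact_support_def)
  obtain c where c: "K \<subseteq> {ereal c..} \<times> {ereal c..}"
    using compactin_upper_plane_bounded_below[OF K(1)] .
  show thesis
  proof (rule that[OF f])
    fix x z assume "- \<infinity> < x" "- \<infinity> < z" "f (x, z) \<noteq> 0"
    hence "(x, z) \<in> K" using K(2) by (auto simp: topspace_upper_plane)
    thus "ereal c \<le> x \<and> ereal c \<le> z" using c by auto
  qed
qed

lemma continuous_map_upper_plane_real:
  assumes "continuous_map upper_plane euclideanreal f"
  shows "continuous_on UNIV (\<lambda>p::real \<times> real. f (ereal (fst p), ereal (snd p)))"
proof -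
  have "continuous_on ({- \<infinity> <..} \<times> {- \<infinity> <..}) f"
    using assms by (simp add: upper_plane_def)
  thus ?thesis
    by (rule continuous_on_compose2) (auto intro!: continuous_intros)
qed

section \<open>The approximating process as a continuous function of the exponential sequence\<close>

definition ordinate :: "nat \<Rightarrow> nat \<Rightarrow> real" where
  "ordinate n i = (real n - real i) / real n * ln (real n)"

definition abscissa :: "real \<Rightarrow> nat \<Rightarrow> nat \<Rightarrow> real \<Rightarrow> real" where
  "abscissa \<gamma> n i y = real i powr \<gamma> * y / real n powr \<gamma> - beta \<gamma> n"

lemma finite_ordinate_ge:
  assumes "n \<ge> 2"
  shows "finite {i. ordinate n i \<ge> c}"
proof (rule finite_subset)
  have L: "ln (real n) > 0" using assms by auto
  show "{i. ordinate n i \<ge> c} \<subseteq> {..nat \<lceil>real n - c * real n / ln (real n)\<rceil>}"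
  proof
    fix i assume "i \<in> {i. ordinate n i \<ge> c}"
    hence "c \<le> (real n - real i) * ln (real n) / real n" by (simp add: ordinate_def)
    hence "c * real n \<le> (real n - real i) * ln (real n)"
      using assms by (simp add: pos_le_divide_eq)
    hence "c * real n / ln (real n) \<le> real n - real i"
      using L by (simp add: pos_divide_le_eq)
    hence "real i \<le> real n - c * real n / ln (real n)" by simp
    also have "\<dots> \<le> real (nat \<lceil>real n - c * real n / ln (real n)\<rceil>)"
      by (rule real_nat_ceiling_ge)
    finally show "i \<in> {..nat \<lceil>real n - c * real n / ln (real n)\<rceil>}" by simp
  qed
qed simp

text \<open>
  The process as a deterministic function of a sequence indexed from 0, so that the sequence space
  is the product over all of \<open>\<nat>\<close>, whose Borel and product sigma-algebras coincide.
\<close>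

definition process_of :: "real \<Rightarrow> nat \<Rightarrow> (nat \<Rightarrow> real) \<Rightarrow> (ereal \<times> ereal) measure" where
  "process_of \<gamma> n y = xi_hat \<gamma> (\<lambda>i y. y (i - 1)) n y"

lemma xi_hat_eq_process_of: "xi_hat \<gamma> X n \<omega> = process_of \<gamma> n (\<lambda>j. X (Suc j) \<omega>)"
  unfolding process_of_def xi_hat_def point_measure_of_def by (rule distr_cong) auto

lemma process_of_eq_distr:
  "process_of \<gamma> n y = distr (count_space {1..}) (borel_of_top upper_plane)
     (\<lambda>i. (ereal (abscissa \<gamma> n i (y (i - 1))), ereal (ordinate n i)))"
  unfolding process_of_def xi_hat_def point_measure_of_def abscissa_def ordinate_def ..

lemma points_measurable:
  "(\<lambda>i. (ereal (a i), ereal (b i))) \<in> measurable (count_space I) (borel_of_top upper_plane)"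
  by (simp add: topspace_upper_plane)

lemma process_of_radon:
  assumes "n \<ge> 2"
  shows "process_of \<gamma> n y \<in> radon_measures upper_plane"
  unfolding radon_measures_def
proof (intro CollectI conjI allI impI)
  fix K assume "compactin upper_plane K"
  then obtain c where c: "K \<subseteq> {ereal c..} \<times> {ereal c..}"
    by (rule compactin_upper_plane_bounded_below)
  show "emeasure (process_of \<gamma> n y) K < \<infinity>"
  proof (cases "K \<in> sets (borel_of_top upper_plane)")
    case True
    let ?p = "\<lambda>i. (ereal (abscissa \<gamma> n i (y (i - 1))), ereal (ordinate n i))"
    have "finite (?p -` K \<inter> {1..})"
      by (rule finite_subset[OF _ finite_ordinate_ge[OF assms, of c]]) (use c in auto)
    thus ?thesis
      using True unfolding process_of_eq_distr
      by (subst emeasure_distr[OF points_measurable])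
         (auto simp: emeasure_count_space topspace_upper_plane of_nat_less_top)
  next
    case False
    thus ?thesis by (simp add: emeasure_notin_sets process_of_eq_distr)
  qed
qed (simp add: process_of_eq_distr)

text \<open>
  A test function sees only the finitely many points above its lower bound, and which indices can
  contribute does not depend on \<open>y\<close>.
\<close>

lemma integral_process_of:
  assumes f: "continuous_map upper_plane euclideanreal f"
    and J: "finite J" "\<And>j. j \<notin> J \<Longrightarrow>
      f (ereal (abscissa \<gamma> n (Suc j) (y j)), ereal (ordinate n (Suc j))) = 0"
  shows "(\<integral>p. f p \<partial>process_of \<gamma> n y) =
    (\<Sum>j\<in>J. f (ereal (abscissa \<gamma> n (Suc j) (y j)), ereal (ordinate n (Suc j))))"
proof -
  let ?g = "\<lambda>i. f (ereal (abscissa \<gamma> n i (y (i - 1))), ereal (ordinate n i))"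
  have sub: "{i \<in> {1..}. ?g i \<noteq> 0} \<subseteq> Suc ` J"
  proof
    fix i assume "i \<in> {i \<in> {1..}. ?g i \<noteq> 0}"
    thus "i \<in> Suc ` J" using J(2)[of "i - 1"] by (cases i) auto
  qed
  have "(\<integral>p. f p \<partial>process_of \<gamma> n y) = (\<integral>i. ?g i \<partial>count_space {1..})"
    unfolding process_of_eq_distr
    by (rule integral_distr[OF points_measurable borel_measurable_of_continuous_map[OF f]])
  also have "\<dots> = (\<Sum>i | i \<in> {1..} \<and> ?g i \<noteq> 0. ?g i)"
    by (rule lebesgue_integral_count_space_finite_support)
       (use finite_subset[OF sub] J(1) in auto)
  also have "\<dots> = (\<Sum>i\<in>Suc ` J. ?g i)"
    by (rule sum.mono_neutral_left) (use sub J(1) in auto)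
  also have "\<dots> = (\<Sum>j\<in>J. ?g (Suc j))"
    by (subst sum.reindex) auto
  finally show ?thesis by simp
qed

text \<open>
  Continuity gives measurability with respect to the Borel sets of the vague topology, which are
  not obviously generated by the maps \<open>\<mu> \<Rightarrow> integral of f\<close>.
\<close>

lemma continuous_map_process_of:
  assumes "n \<ge> 2"
  shows "continuous_map euclidean (vague_topology upper_plane) (process_of \<gamma> n)"
  unfolding vague_topology_def
proof (rule continuous_on_generated_topo)
  let ?S = "{{\<mu> \<in> radon_measures upper_plane. (\<integral>x. f x \<partial>\<mu>) \<in> U} | f U.
    f \<in> cont_compact_support upper_plane \<and> open (U :: real set)}"
  fix V assume "V \<in> ?S"
  then obtain f U where V: "V = {\<mu> \<in> radon_measures upper_plane. (\<integral>x. f x \<partial>\<mu>) \<in> U}"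
    and f: "f \<in> cont_compact_support upper_plane" and U: "open U" by auto
  obtain c where fc: "continuous_map upper_plane euclideanreal f"
    and c: "\<And>x z. - \<infinity> < x \<Longrightarrow> - \<infinity> < z \<Longrightarrow> f (x, z) \<noteq> 0 \<Longrightarrow> ereal c \<le> x \<and> ereal c \<le> z"
    using cont_compact_support_upper_plane[OF f] by blast
  define J where "J = {j. ordinate n (Suc j) \<ge> c}"
  have "Suc ` J \<subseteq> {i. ordinate n i \<ge> c}" by (auto simp: J_def)
  hence J: "finite J"
    using finite_ordinate_ge[OF assms, of c] by (meson finite_subset finite_imageD inj_Suc)
  have int: "(\<integral>p. f p \<partial>process_of \<gamma> n y) =
    (\<Sum>j\<in>J. f (ereal (abscissa \<gamma> n (Suc j) (y j)), ereal (ordinate n (Suc j))))" for y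
    by (rule integral_process_of[OF fc J]) (use c in \<open>force simp: J_def\<close>)
  have cont: "continuous_on UNIV (\<lambda>y. \<integral>p. f p \<partial>process_of \<gamma> n y)"
    unfolding int abscissa_def divide_inverse
    by (intro continuous_on_sum
        continuous_on_compose2[OF continuous_map_upper_plane_real[OF fc],
          where f = "\<lambda>y. (abscissa \<gamma> n (Suc j) (y j), ordinate n (Suc j))" for j,
          unfolded abscissa_def divide_inverse fst_conv snd_conv]
        continuous_intros continuous_on_product_coordinates) auto
  have "process_of \<gamma> n -` V \<inter> topspace euclidean = (\<lambda>y. \<integral>p. f p \<partial>process_of \<gamma> n y) -` U"
    using process_of_radon[OF assms] by (auto simp: V)
  also have "open \<dots>"
    using continuous_on_open_vimage[of UNIV] cont U by auto
  finally show "openin euclidean (process_of \<gamma> n -` V \<inter> topspace euclidean)"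
    by simp
next
  have "\<Union>{{\<mu> \<in> radon_measures upper_plane. (\<integral>x. f x \<partial>\<mu>) \<in> U} | f U.
    f \<in> cont_compact_support upper_plane \<and> open (U :: real set)} = radon_measures upper_plane"
    using topspace_vague_topology[of upper_plane]
    unfolding vague_topology_def topology_generated_by_topspace .
  thus "process_of \<gamma> n ` topspace euclidean \<subseteq>
     \<Union>{{\<mu> \<in> radon_measures upper_plane. (\<integral>x. f x \<partial>\<mu>) \<in> U} | f U.
       f \<in> cont_compact_support upper_plane \<and> open (U :: real set)}"
    using process_of_radon[OF assms] by auto
qed

section \<open>Asymptotics of the change of variables\<close>

text \<open>
  The mean number of points of the limit process with positive abscissa and ordinate between two
  consecutive ordinates of the approximating process.
\<close>

definition strip_mass :: "real \<Rightarrow> nat \<Rightarrow> nat \<Rightarrow> real" where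
  "strip_mass \<gamma> n j = exp (- \<gamma> * ordinate n (Suc j)) - exp (- \<gamma> * ordinate n j)"

text \<open>
  If \<open>P(G \<le> t) = exp (- w * exp (- t))\<close> for all \<open>t\<close>, then this function turns \<open>G\<close> into a standard
  exponential variable.
\<close>

definition gumbel_to_exponential :: "real \<Rightarrow> real \<Rightarrow> real" where
  "gumbel_to_exponential w t = - ln (1 - exp (- (w * exp (- t))))"

abbreviation coupled_abscissa :: "real \<Rightarrow> nat \<Rightarrow> nat \<Rightarrow> real \<Rightarrow> real" where
  "coupled_abscissa \<gamma> n j t \<equiv>
     abscissa \<gamma> n (Suc j) (gumbel_to_exponential (strip_mass \<gamma> n j) t)"

lemma ordinate_Suc: "ordinate n j = ordinate n (Suc j) + ln (real n) / real n"
  by (cases "n = 0") (simp_all add: ordinate_def field_simps)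

lemma ordinate_less:
  assumes "n \<ge> 2" "i < j"
  shows "ordinate n j < ordinate n i"
  unfolding ordinate_def using assms
  by (intro mult_strict_right_mono divide_strict_right_mono) auto

lemma strip_mass_eq:
  "strip_mass \<gamma> n j = exp (- \<gamma> * ordinate n (Suc j)) * (1 - exp (- (\<gamma> * ln (real n) / real n)))"
  unfolding strip_mass_def ordinate_Suc[of n j]
  by (simp add: algebra_simps flip: exp_add)

lemma strip_mass_pos:
  assumes "\<gamma> > 0" "n \<ge> 2"
  shows "strip_mass \<gamma> n j > 0"
  using assms by (simp add: strip_mass_eq)

lemma beta_eq:
  assumes "\<gamma> > 0" "n \<ge> 2"
  shows "beta \<gamma> n = ln (real n) - ln \<gamma> - ln (ln (real n))"
  using assms by (simp add: beta_def ln_div)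

lemma exp_minus_beta:
  assumes "\<gamma> > 0" "n \<ge> 2"
  shows "exp (- beta \<gamma> n) = \<gamma> * ln (real n) / real n"
  using assms by (simp add: beta_eq exp_diff exp_add exp_minus field_simps)

lemma abscissa_eq:
  "abscissa \<gamma> n i y = (real i / real n) powr \<gamma> * y - beta \<gamma> n"
  by (simp add: abscissa_def powr_divide)

lemma one_minus_exp_lower:
  assumes "0 \<le> y" "y \<le> (1::real)"
  shows "y / 2 \<le> 1 - exp (- y)"
proof -
  have "exp (- y) \<le> 1 / (1 + y)"
    using exp_ge_add_one_self[of y] assms by (simp add: exp_minus field_simps)
  also have "\<dots> \<le> 1 - y / 2"
    using assms mult_left_mono[of y 1 y] by (simp add: field_simps)
  finally show ?thesis by simp
qed

text \<open>
  A point of the coupled process above level \<open>x\<^sub>0\<close> comes from a Poisson point above some level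
  \<open>x\<^sub>1\<close>, uniformly over all strips that meet a half plane, including those with index much
  smaller than \<open>n\<close>, where the change of variables is not close to the identity. The estimate behind
  this is convexity: for \<open>s = i / n \<le> 1\<close> one has \<open>s powr (- \<gamma>) \<ge> 1 + y + y\<^sup>2 / 2\<close> with
  \<open>y = \<gamma> * (1 - s)\<close>, and multiplied by \<open>beta \<gamma> n\<close> the quadratic term absorbs the error \<open>y * ln (ln n)\<close>.
\<close>

lemma coupled_abscissa_lower_bound:
  assumes \<gamma>: "\<gamma> > 0"
  obtains x1 where "\<And>z0. \<forall>\<^sub>F n in sequentially. \<forall>j t. ordinate n (Suc j) \<ge> z0 \<longrightarrow>
    coupled_abscissa \<gamma> n j t \<ge> x0 \<longrightarrow> t \<ge> x1"
proof -
  define a where "a = max 0 (- x0)"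
  have a: "a \<ge> 0" "- a \<le> x0" by (auto simp: a_def)
  have "\<forall>\<^sub>F n in sequentially. \<forall>j t. ordinate n (Suc j) \<ge> z0 \<longrightarrow>
      coupled_abscissa \<gamma> n j t \<ge> x0 \<longrightarrow> t \<ge> - (ln 4 + a + 1)" for z0
  proof -
    define K where "K n = a + ln \<gamma> + ln (ln (real n))" for n :: nat
    have "\<forall>\<^sub>F n in sequentially. n \<ge> (2::nat)"
      by (rule eventually_ge_at_top)
    moreover have "\<forall>\<^sub>F n::nat in sequentially. \<gamma> * ln (real n) / real n \<le> 1"
      using \<gamma> by real_asymp
    moreover have "\<forall>\<^sub>F n::nat in sequentially. beta \<gamma> n - a > 0"
      unfolding beta_def using \<gamma> by real_asymp
    moreover have "\<forall>\<^sub>F n::nat in sequentially. K n ^ 2 \<le> 2 * (beta \<gamma> n - a)"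
      unfolding beta_def K_def using \<gamma> by real_asymp
    moreover have "\<forall>\<^sub>F n::nat in sequentially. K n \<ge> 0"
      unfolding K_def by real_asymp
    moreover have "\<forall>\<^sub>F n::nat in sequentially. ln 2 \<le> (beta \<gamma> n - a) * 2 powr (- \<gamma>)"
      unfolding beta_def using \<gamma> by real_asymp
    moreover have "\<forall>\<^sub>F n::nat in sequentially. \<bar>z0\<bar> \<le> ln (real n)"
      by real_asymp
    ultimately show ?thesis
    proof eventually_elim
      case (elim n)
      show ?case
      proof (intro allI impI)
        fix j t
        assume z: "ordinate n (Suc j) \<ge> z0" and x: "coupled_abscissa \<gamma> n j t \<ge> x0"
        define L \<beta> w s B where "L = ln (real n)" and "\<beta> = beta \<gamma> n" and "w = strip_mass \<gamma> n j"
          and "s = real (Suc j) / real n" and "B = beta \<gamma> n - a"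
        define v y r where "v = w * exp (- t)" and "y = \<gamma> * (1 - s)" and "r = B * s powr (- \<gamma>)"
        have n: "real n > 0" and L: "L > 0" using elim by (auto simp: L_def)
        have s: "s > 0" using n by (simp add: s_def)
        have B: "B > 0" using elim by (simp add: B_def)
        have ord: "ordinate n (Suc j) = (1 - s) * L"
          using n by (simp add: ordinate_def s_def L_def diff_divide_distrib)
        have w: "w > 0" using strip_mass_pos[OF \<gamma>] elim by (simp add: w_def)
        have v: "v > 0" using w by (simp add: v_def)
        have "s \<le> 2"
        proof (rule ccontr)
          assume "\<not> s \<le> 2"
          hence "(1 - s) * L < (- 1) * L" using L by (intro mult_strict_right_mono) auto
          also have "\<dots> \<le> z0" using elim by (simp add: L_def abs_le_iff)
          finally show False using z ord by simp
        qed
        hence s_powr: "s powr (- \<gamma>) \<ge> 2 powr (- \<gamma>)"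
          using s \<gamma> by (intro powr_mono2') auto
        have "ln 2 \<le> B * 2 powr (- \<gamma>)" using elim by (simp add: B_def)
        also have "\<dots> \<le> r" unfolding r_def using s_powr B by (intro mult_left_mono) auto
        finally have "exp (- r) \<le> exp (- ln 2)" by simp
        hence q: "exp (- r) \<le> 1 / 2" by (simp add: exp_minus)

        have "s powr \<gamma> * (- ln (1 - exp (- v))) \<ge> B"
          using x a(2) by (simp add: abscissa_eq gumbel_to_exponential_def v_def w_def s_def B_def)
        hence "r \<le> - ln (1 - exp (- v))"
          using s by (simp add: r_def powr_minus field_simps)
        hence "ln (1 - exp (- v)) \<le> - r" by simp
        hence "exp (ln (1 - exp (- v))) \<le> exp (- r)" by (simp only: exp_le_cancel_iff)
        hence "1 - exp (- v) \<le> exp (- r)" using v by simp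
        hence "1 - exp (- r) \<le> exp (- v)" by simp
        hence "ln (1 - exp (- r)) \<le> ln (exp (- v))"
          using q by (intro ln_mono) linarith+
        hence "v \<le> - ln (1 - exp (- r))" by simp
        also have "\<dots> \<le> exp (- r) + 2 * (exp (- r))\<^sup>2"
          using ln_one_minus_pos_lower_bound[of "exp (- r)"] q by simp
        also have "\<dots> \<le> 2 * exp (- r)"
          using mult_left_mono[OF q, of "2 * exp (- r)"] by (simp add: power2_eq_square)
        finally have v_le: "v \<le> 2 * exp (- r)" .

        have y_ord: "\<gamma> * ordinate n (Suc j) = y * L"
          by (simp add: ord y_def)
        have "exp (- \<beta>) / 2 \<le> 1 - exp (- (\<gamma> * L / real n))"
          using one_minus_exp_lower[of "\<gamma> * L / real n"] elim \<gamma> L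
            exp_minus_beta[OF \<gamma>, of n] by (simp add: \<beta>_def L_def)
        hence "exp (- (y * L)) * (exp (- \<beta>) / 2) \<le> w"
          unfolding w_def strip_mass_eq using y_ord by (simp add: L_def)
        hence "exp (- (y * L)) * (exp (- \<beta>) / 2) * exp (- t) \<le> v"
          unfolding v_def by (intro mult_right_mono) auto
        hence "exp (- (y * L) - \<beta> - t) \<le> 2 * v"
          by (simp add: exp_diff exp_minus exp_add field_simps)
        also have "\<dots> \<le> exp (ln 4 - r)"
          using v_le by (simp add: exp_diff exp_minus field_simps)
        finally have t: "- t \<le> ln 4 + (y * L + \<beta> - r)" by simp

        have L_eq: "L = \<beta> + ln \<gamma> + ln L"
          using beta_eq[OF \<gamma>, of n] elim by (simp add: \<beta>_def L_def)
        have yL: "y * L = y * \<beta> + y * ln \<gamma> + y * ln L"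
          using arg_cong[OF L_eq, of "\<lambda>u. y * u"] by (simp add: distrib_left)
        have "ln s \<le> s - 1" using s by (rule ln_le_minus_one)
        hence "\<gamma> * ln s \<le> \<gamma> * (s - 1)" using \<gamma> by (intro mult_left_mono) auto
        hence "y \<le> - \<gamma> * ln s"
          by (simp add: y_def algebra_simps)
        hence exp_y: "exp y \<le> s powr (- \<gamma>)"
          using s by (simp add: powr_def)
        have "y * L + \<beta> - r \<le> a + 1"
        proof (cases "y \<ge> 0")
          case True
          have "1 + y + y\<^sup>2 / 2 \<le> s powr (- \<gamma>)"
            using exp_lower_Taylor_quadratic[OF True] exp_y by linarith
          hence "B * (1 + y + y\<^sup>2 / 2) \<le> r"
            unfolding r_def using B by (intro mult_left_mono) auto
          hence "y * L + \<beta> - r \<le> y * L + \<beta> - B * (1 + y + y\<^sup>2 / 2)" by simp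
          also have "\<dots> = a + K n * y - B * y\<^sup>2 / 2"
            unfolding yL by (simp add: B_def K_def \<beta>_def algebra_simps flip: L_def)
          also have "\<dots> \<le> a + 1"
          proof -
            \<comment> \<open>completing the square\<close>
            have "0 \<le> (2 - K n * y)\<^sup>2" by simp
            hence "4 * (K n * y) \<le> 4 + (K n)\<^sup>2 * y\<^sup>2"
              by (simp add: power2_eq_square algebra_simps)
            also have "\<dots> \<le> 4 + 2 * B * y\<^sup>2"
              using elim by (intro add_left_mono mult_right_mono) (auto simp: B_def)
            finally show ?thesis by simp
          qed
          finally show ?thesis .
        next
          case False
          have "1 + y \<le> s powr (- \<gamma>)"
            using exp_ge_add_one_self[of y] exp_y by linarith
          hence "B * (1 + y) \<le> r"
            unfolding r_def using B by (intro mult_left_mono) auto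
          hence "y * L + \<beta> - r \<le> y * L + \<beta> - B * (1 + y)" by simp
          also have "\<dots> = a + K n * y"
            unfolding yL by (simp add: B_def K_def \<beta>_def algebra_simps flip: L_def)
          also have "\<dots> \<le> a + 1"
            using False elim mult_nonneg_nonpos[of "K n" y] by simp
          finally show ?thesis .
        qed
        with t show "t \<ge> - (ln 4 + a + 1)" by simp
      qed
    qed
  qed
  thus thesis by (rule that)
qed

text \<open>
  Near a fixed ordinate the change of variables tends to the identity: with \<open>s = i / n\<close>, the
  logarithm of the strip mass contributes \<open>\<gamma> * (1 - s) * ln n + beta \<gamma> n\<close>, and the limits
  \<open>\<gamma> * z\<close> of the first term and \<open>- \<gamma> * z\<close> of \<open>(s powr \<gamma> - 1) * beta \<gamma> n\<close> cancel.
\<close>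

lemma coupled_abscissa_tendsto:
  assumes \<gamma>: "\<gamma> > 0"
    and lim: "(\<lambda>n. ordinate n (Suc (j n))) \<longlonglongrightarrow> z"
  shows "(\<lambda>n. coupled_abscissa \<gamma> n (j n) t) \<longlonglongrightarrow> t"
proof -
  define ord where "ord n = ordinate n (Suc (j n))" for n
  define s where "s n = real (Suc (j n)) / real n" for n
  define \<delta> where "\<delta> n = 1 - exp (- (\<gamma> * ln (real n) / real n))" for n
  define v where "v n = strip_mass \<gamma> n (j n) * exp (- t)" for n
  define e where "e n = - ln (\<delta> n) - beta \<gamma> n" for n
  have ord_lim: "ord \<longlonglongrightarrow> z" using lim unfolding ord_def .
  have ord_eq: "ord n = (1 - s n) * ln (real n)" if "n \<ge> 2" for n
    using that by (simp add: ord_def ordinate_def s_def diff_divide_distrib)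
  have inv_ln: "(\<lambda>n::nat. inverse (ln (real n))) \<longlonglongrightarrow> 0" by real_asymp
  have "(\<lambda>n. 1 - ord n * inverse (ln (real n))) \<longlonglongrightarrow> 1 - z * 0"
    by (intro tendsto_intros ord_lim inv_ln)
  moreover have "\<forall>\<^sub>F n in sequentially. 1 - ord n * inverse (ln (real n)) = s n"
    using eventually_ge_at_top[of 2] by eventually_elim (auto simp: ord_eq field_simps)
  ultimately have s_lim: "s \<longlonglongrightarrow> 1" by (simp add: tendsto_cong)
  have e_lim: "e \<longlonglongrightarrow> 0"
    unfolding e_def \<delta>_def beta_def using \<gamma> by (real_asymp simp: ln_inverse)
  have \<delta>_lim: "\<delta> \<longlonglongrightarrow> 0"
    unfolding \<delta>_def using \<gamma> by real_asymp
  have v_eq: "v n = exp (- \<gamma> * ord n) * \<delta> n * exp (- t)" for n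
    by (simp add: v_def strip_mass_eq ord_def \<delta>_def)
  have "v \<longlonglongrightarrow> exp (- \<gamma> * z) * 0 * exp (- t)"
    unfolding v_eq by (intro tendsto_intros ord_lim \<delta>_lim)
  moreover have v_pos: "\<forall>\<^sub>F n in sequentially. v n > 0"
    using eventually_ge_at_top[of 2]
    by eventually_elim (use strip_mass_pos[OF \<gamma>] in \<open>simp add: v_def\<close>)
  ultimately have "filterlim v (at_right 0) sequentially"
    by (auto simp: filterlim_at elim: eventually_mono)
  moreover have "((\<lambda>u::real. ln ((1 - exp (- u)) / u)) \<longlongrightarrow> 0) (at_right 0)"
    by real_asymp
  ultimately have q_lim: "(\<lambda>n. ln ((1 - exp (- v n)) / v n)) \<longlonglongrightarrow> 0"
    by (rule filterlim_compose[rotated])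

  \<comment> \<open>the difference quotient at 1, extended continuously\<close>
  have "((\<lambda>x::real. x powr \<gamma>) has_field_derivative \<gamma>) (at 1)"
    by (auto intro!: derivative_eq_intros)
  then obtain \<phi> where \<phi>: "\<And>x. x powr \<gamma> - 1 powr \<gamma> = \<phi> x * (x - 1)" "isCont \<phi> 1" "\<phi> 1 = \<gamma>"
    by (auto simp: CARAT_DERIV)
  have \<phi>_lim: "(\<lambda>n. \<phi> (s n)) \<longlonglongrightarrow> \<gamma>"
    using isCont_tendsto_compose[OF \<phi>(2) s_lim] \<phi>(3) by simp
  have beta_lim: "(\<lambda>n. beta \<gamma> n / ln (real n)) \<longlonglongrightarrow> 1"
    unfolding beta_def using \<gamma> by real_asymp
  have s_powr_lim: "(\<lambda>n. s n powr \<gamma>) \<longlonglongrightarrow> 1 powr \<gamma>"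
    by (intro tendsto_intros s_lim) auto
  have "(\<lambda>n. s n powr \<gamma> * (\<gamma> * ord n + t + e n - ln ((1 - exp (- v n)) / v n)) -
      \<phi> (s n) * (ord n * (beta \<gamma> n / ln (real n))))
      \<longlonglongrightarrow> 1 powr \<gamma> * (\<gamma> * z + t + 0 - 0) - \<gamma> * (z * 1)"
    by (intro tendsto_intros s_powr_lim ord_lim e_lim q_lim \<phi>_lim beta_lim)
  moreover have "\<forall>\<^sub>F n in sequentially.
      s n powr \<gamma> * (\<gamma> * ord n + t + e n - ln ((1 - exp (- v n)) / v n)) -
      \<phi> (s n) * (ord n * (beta \<gamma> n / ln (real n))) = coupled_abscissa \<gamma> n (j n) t"
    using eventually_ge_at_top[of 2] v_pos
  proof eventually_elim
    case (elim n)
    have L: "ln (real n) > 0" using elim by simp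
    have \<delta>: "\<delta> n > 0"
      using elim \<gamma> by (simp add: \<delta>_def)
    have "ln (v n) = - \<gamma> * ord n + ln (\<delta> n) - t"
      unfolding v_eq using \<delta> by (simp add: ln_mult)
    moreover have "ln ((1 - exp (- v n)) / v n) = ln (1 - exp (- v n)) - ln (v n)"
      using elim by (simp add: ln_div)
    ultimately have h: "gumbel_to_exponential (strip_mass \<gamma> n (j n)) t =
        \<gamma> * ord n + t + e n + beta \<gamma> n - ln ((1 - exp (- v n)) / v n)"
      by (simp add: gumbel_to_exponential_def e_def v_def)
    moreover have "\<phi> (s n) * (ord n * (beta \<gamma> n / ln (real n))) = - (s n powr \<gamma> - 1) * beta \<gamma> n"
    proof -
      have "ord n * (beta \<gamma> n / ln (real n)) = (1 - s n) * beta \<gamma> n"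
        using L elim by (simp add: ord_eq)
      moreover have "s n powr \<gamma> - 1 = \<phi> (s n) * (s n - 1)"
        using \<phi>(1)[of "s n"] by simp
      ultimately show ?thesis by (simp only:) (simp add: algebra_simps)
    qed
    moreover have "coupled_abscissa \<gamma> n (j n) t =
        s n powr \<gamma> * gumbel_to_exponential (strip_mass \<gamma> n (j n)) t - beta \<gamma> n"
      by (simp only: abscissa_eq s_def)
    ultimately show ?case
      by (simp only: h) (simp add: algebra_simps)
  qed
  ultimately show ?thesis by (simp add: tendsto_cong)
qed

text \<open>The strips become thin: for large \<open>n\<close> the one containing \<open>z\<close> has both edges near \<open>z\<close>.\<close>

lemma strip_index_exists:
  obtains j :: "nat \<Rightarrow> nat" where
    "\<forall>\<^sub>F n in sequentially. ordinate n (Suc (j n)) < z \<and> z \<le> ordinate n (j n)"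
    "(\<lambda>n. ordinate n (Suc (j n))) \<longlonglongrightarrow> z"
proof -
  define j where "j n = nat \<lfloor>real n * (1 - z / ln (real n))\<rfloor>" for n :: nat
  have "\<forall>\<^sub>F n::nat in sequentially. z \<le> ln (real n)" by real_asymp
  with eventually_ge_at_top[of 2]
  have ev: "\<forall>\<^sub>F n in sequentially. ordinate n (Suc (j n)) < z \<and> z \<le> ordinate n (j n)"
  proof eventually_elim
    case (elim n)
    define y where "y = real n * (1 - z / ln (real n))"
    have L: "ln (real n) > 0" and n: "real n > 0" using elim by auto
    have "y \<ge> 0" using elim L n by (simp add: y_def)
    hence y: "real (j n) \<le> y" "y < real (Suc (j n))"
      unfolding j_def y_def[symmetric] by linarith+
    have z: "z = (real n - y) / real n * ln (real n)"
      using n L by (simp add: y_def field_simps)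
    have "ordinate n (Suc (j n)) < z"
      unfolding ordinate_def z using y(2) n L
      by (intro mult_strict_right_mono divide_strict_right_mono) auto
    moreover have "z \<le> ordinate n (j n)"
      unfolding ordinate_def z using y(1) n L
      by (intro mult_right_mono divide_right_mono) auto
    ultimately show ?case ..
  qed
  have "(\<lambda>n. ordinate n (Suc (j n))) \<longlonglongrightarrow> z"
  proof (rule tendsto_sandwich)
    show "\<forall>\<^sub>F n in sequentially. z - ln (real n) / real n \<le> ordinate n (Suc (j n))"
      using ev by eventually_elim (simp add: ordinate_Suc[of _ "j _"])
    show "\<forall>\<^sub>F n in sequentially. ordinate n (Suc (j n)) \<le> z"
      using ev by eventually_elim simp
    show "(\<lambda>n. z - ln (real n) / real n) \<longlonglongrightarrow> z" by real_asymp
  qed simp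
  with ev show thesis by (rule that)
qed

section \<open>Atoms of integer-valued measures\<close>

text \<open>
  The open set of points with a null neighbourhood is a countable union of null basic sets. A point
  outside it has mass at least 1, being the intersection of a decreasing sequence of neighbourhoods
  of mass at least 1, and only finitely many such points fit into finite total mass.
\<close>

lemma finitely_many_atoms:
  fixes \<nu> :: "'a :: {second_countable_topology, t2_space} measure"
  assumes B: "countable B" "topological_basis B"
    and W: "open W" "emeasure \<nu> W < \<infinity>"
    and sets: "\<And>U. open U \<Longrightarrow> U \<subseteq> W \<Longrightarrow> U \<in> sets \<nu>"
    and jump: "\<And>b. b \<in> B \<Longrightarrow> emeasure \<nu> (b \<inter> W) = 0 \<or> emeasure \<nu> (b \<inter> W) \<ge> 1"
  obtains A where "finite A" "A \<subseteq> W" "emeasure \<nu> (W - A) = 0"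
    "\<And>p. p \<in> A \<Longrightarrow> {p} \<in> sets \<nu> \<and> emeasure \<nu> {p} \<ge> 1"
proof -
  define Z where "Z = (\<Union>b\<in>{b \<in> B. emeasure \<nu> (b \<inter> W) = 0}. b \<inter> W)"
  define A where "A = W - Z"
  have B_sets: "b \<inter> W \<in> sets \<nu>" if "b \<in> B" for b
    using that W(1) topological_basis_open[OF B(2)] by (intro sets) auto
  have "Z \<in> null_sets \<nu>"
    unfolding Z_def using B(1) B_sets
    by (intro null_sets_UN') (auto intro: countable_subset)
  hence Z: "emeasure \<nu> Z = 0" "Z \<in> sets \<nu>" by auto
  have W_sets: "W \<in> sets \<nu>" using W(1) by (intro sets) auto
  have open_ge: "emeasure \<nu> (U \<inter> W) \<ge> 1" if p: "p \<in> A" "open U" "p \<in> U" for p U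
  proof -
    have "p \<in> W" "p \<notin> Z" using p(1) by (auto simp: A_def)
    obtain b where b: "b \<in> B" "p \<in> b" "b \<subseteq> U"
      using topological_basisE[OF B(2) p(2,3)] by blast
    have "emeasure \<nu> (b \<inter> W) \<noteq> 0"
      using b \<open>p \<in> W\<close> \<open>p \<notin> Z\<close> by (auto simp: Z_def)
    hence "1 \<le> emeasure \<nu> (b \<inter> W)" using jump b(1) by auto
    also have "\<dots> \<le> emeasure \<nu> (U \<inter> W)"
      by (rule emeasure_mono) (use b(3) p(2) W(1) in \<open>auto intro!: sets\<close>)
    finally show ?thesis .
  qed
  have point: "{p} \<in> sets \<nu> \<and> emeasure \<nu> {p} \<ge> 1" if p: "p \<in> A" for p
  proof -
    obtain N :: "nat \<Rightarrow> 'a set" where N: "\<And>i. open (N i)" "\<And>i. p \<in> N i"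
      "\<And>S. open S \<Longrightarrow> p \<in> S \<Longrightarrow> \<forall>\<^sub>F i in sequentially. N i \<subseteq> S"
      by (rule countable_basis_at_decseq[of p]) blast
    define C where "C k = (\<Inter>i\<le>k. N i) \<inter> W" for k
    have C_open: "open (C k)" for k
      unfolding C_def using N(1) W(1) by (intro open_Int open_INT) auto
    have C_sets: "C k \<in> sets \<nu>" for k
      by (rule sets[OF C_open]) (auto simp: C_def)
    have Int_C: "(\<Inter>k. C k) = {p}"
    proof (intro equalityI subsetI)
      fix q assume q: "q \<in> (\<Inter>k. C k)"
      show "q \<in> {p}"
      proof (rule ccontr)
        assume "q \<notin> {p}"
        then obtain S where S: "open S" "p \<in> S" "q \<notin> S"
          using hausdorff[of p q] by blast
        obtain i where "N i \<subseteq> S"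
          using N(3)[OF S(1,2)] by (auto simp: eventually_sequentially)
        thus False using q S(3) by (auto simp: C_def)
      qed
    qed (use p N(2) in \<open>auto simp: C_def A_def\<close>)
    have "(\<lambda>k. emeasure \<nu> (C k)) \<longlonglongrightarrow> emeasure \<nu> (\<Inter>k. C k)"
    proof (rule Lim_emeasure_decseq)
      show "range C \<subseteq> sets \<nu>" using C_sets by auto
      show "decseq C" by (auto simp: decseq_def C_def)
      show "emeasure \<nu> (C k) \<noteq> \<infinity>" for k
      proof -
        have "emeasure \<nu> (C k) \<le> emeasure \<nu> W"
          by (rule emeasure_mono) (auto simp: C_def W_sets)
        thus ?thesis using W(2) by (auto simp: top_unique)
      qed
    qed
    moreover have "1 \<le> emeasure \<nu> (C k)" for k
    proof -
      have "1 \<le> emeasure \<nu> ((\<Inter>i\<le>k. N i) \<inter> W)"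
        by (rule open_ge[OF p]) (use N in \<open>auto intro: open_INT\<close>)
      thus ?thesis by (simp add: C_def)
    qed
    ultimately have "1 \<le> emeasure \<nu> (\<Inter>k. C k)"
      by (intro LIMSEQ_le_const) auto
    moreover have "(\<Inter>k. C k) \<in> sets \<nu>" using C_sets by blast
    ultimately show ?thesis by (simp add: Int_C)
  qed
  have card_le: "of_nat (card F) \<le> emeasure \<nu> W" if F: "finite F" "F \<subseteq> A" for F
  proof -
    have "of_nat (card F) = (\<Sum>p\<in>F. 1 :: ennreal)" by simp
    also have "\<dots> \<le> (\<Sum>p\<in>F. emeasure \<nu> {p})"
      using point F by (intro sum_mono) auto
    also have "\<dots> = emeasure \<nu> F"
      using point F by (intro emeasure_eq_sum_singleton[symmetric]) auto
    also have "\<dots> \<le> emeasure \<nu> W"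
      by (rule emeasure_mono) (use F W_sets in \<open>auto simp: A_def\<close>)
    finally show ?thesis .
  qed
  have "finite A"
  proof (rule ccontr)
    assume "infinite A"
    obtain r where r: "emeasure \<nu> W = ennreal r" "r \<ge> 0"
      using W(2) by (cases "emeasure \<nu> W") auto
    obtain F where F: "F \<subseteq> A" "finite F" "card F = Suc (nat \<lceil>r\<rceil>)"
      using infinite_arbitrarily_large[OF \<open>infinite A\<close>] by blast
    have "ennreal (real (card F)) \<le> ennreal r"
      using card_le[OF F(2,1)] r by (simp add: ennreal_of_nat_eq_real_of_nat)
    hence "real (card F) \<le> r" using r(2) by simp
    thus False using F(3) by linarith
  qed
  moreover have "W - A = Z" by (auto simp: A_def Z_def)
  ultimately show thesis
    using that[of A] point Z by (auto simp: A_def)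
qed

section \<open>The mean measure of half strips\<close>

definition half_strip :: "real \<Rightarrow> ereal \<Rightarrow> ereal \<Rightarrow> (ereal \<times> ereal) set" where
  "half_strip a b d = {ereal a<..} \<times> {b<..d}"

lemma half_strip_sets:
  "half_strip a b d \<in> sets (borel_of_top upper_plane)"
  unfolding half_strip_def
  by (rule sets_upper_planeI) (auto simp: borel_prod[symmetric])

lemma half_strip_unbounded: "half_strip a b \<infinity> = {ereal a<..} \<times> {b<..}"
  by (auto simp: half_strip_def)

lemma open_half_strip_unbounded: "open (half_strip a b \<infinity>)"
  unfolding half_strip_unbounded by (intro open_Times) auto

lemma half_strip_mono:
  assumes "a' \<le> a" "b' \<le> b" "d \<le> d'"
  shows "half_strip a b d \<subseteq> half_strip a' b' d'"
proof -
  have "{ereal a<..} \<subseteq> {ereal a'<..}"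
    using assms(1) by (simp add: greaterThan_subset_iff)
  moreover have "{b<..d} \<subseteq> {b'<..d'}"
    using assms(2,3) by (auto intro: le_less_trans order_trans)
  ultimately show ?thesis unfolding half_strip_def by (rule Sigma_mono)
qed

lemma half_strip_subset_upper_plane: "half_strip a b d \<subseteq> {- \<infinity> <..} \<times> {- \<infinity> <..}"
  by (auto simp: half_strip_def)

lemma emeasure_exponential_density_greaterThan:
  assumes "c > 0"
  shows "emeasure (density lborel (\<lambda>z. ennreal (c * exp (- c * z)))) {b<..} = ennreal (exp (- c * b))"
proof -
  have "emeasure (density lborel (\<lambda>z. ennreal (c * exp (- c * z)))) {b<..} =
      (\<integral>\<^sup>+z. ennreal (c * exp (- c * z)) * indicator {b<..} z \<partial>lborel)"
    by (subst emeasure_density) auto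
  also have "\<dots> = (\<integral>\<^sup>+z. ennreal (c * exp (- c * z)) * indicator {b..} z \<partial>lborel)"
    by (rule nn_integral_cong_AE, rule eventually_mono[OF AE_lborel_singleton[of b]])
       (auto simp: indicator_def)
  also have "\<dots> = ennreal (0 - (- exp (- c * b)))"
  proof (rule nn_integral_FTC_atLeast)
    show "((\<lambda>z. - exp (- c * z)) \<longlongrightarrow> 0) at_top"
      using assms by real_asymp
  qed (use assms in \<open>auto intro!: derivative_eq_intros\<close>)
  finally show ?thesis by simp
qed

lemma real_to_upper_plane_measurable:
  "(\<lambda>(x, z). (ereal x, ereal z)) \<in> measurable (borel :: (real \<times> real) measure) (borel_of_top upper_plane)"
  unfolding borel_of_top_def
proof (rule measurable_measure_of)
  fix U assume "U \<in> {U. openin upper_plane U}"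
  hence "open U" using open_upper_plane
    by (auto simp: upper_plane_def openin_open_eq)
  have "continuous_on UNIV (\<lambda>p::real \<times> real. (ereal (fst p), ereal (snd p)))"
    by (intro continuous_intros)
  hence "open ((\<lambda>p::real \<times> real. (ereal (fst p), ereal (snd p))) -` U)"
    using \<open>open U\<close> continuous_on_open_vimage[of UNIV] by auto
  thus "(\<lambda>(x, z). (ereal x, ereal z)) -` U \<inter> space borel \<in> sets (borel :: (real \<times> real) measure)"
    by (simp add: case_prod_beta')
qed (use openin_subset[of upper_plane] in \<open>auto simp: topspace_upper_plane\<close>)

lemma sets_mu_hat [simp]: "sets (mu_hat \<gamma>) = sets (borel_of_top upper_plane)"
  by (simp add: mu_hat_def)

lemma emeasure_mu_hat_Times:
  assumes "\<gamma> > 0" "B \<in> sets (borel_of_top upper_plane)" "S \<in> sets borel" "T \<in> sets borel"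
    and "\<And>x z. (ereal x, ereal z) \<in> B \<longleftrightarrow> x \<in> S \<and> z \<in> T"
  shows "emeasure (mu_hat \<gamma>) B = emeasure (density lborel (\<lambda>x. ennreal (exp (- x)))) S *
     emeasure (density lborel (\<lambda>z. ennreal (\<gamma> * exp (- \<gamma> * z)))) T"
proof -
  let ?M1 = "density lborel (\<lambda>x::real. ennreal (exp (- x)))"
  let ?M2 = "density lborel (\<lambda>z::real. ennreal (\<gamma> * exp (- \<gamma> * z)))"
  interpret M2: sigma_finite_measure ?M2
    by (subst sigma_finite_measure.sigma_finite_iff_density_finite[OF lborel.sigma_finite_measure_axioms]) auto
  have sets_pair: "sets (?M1 \<Otimes>\<^sub>M ?M2) = sets (borel :: (real \<times> real) measure)"
    by (subst borel_prod[symmetric]) (rule sets_pair_measure_cong, simp_all)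
  hence \<iota>: "(\<lambda>(x, z). (ereal x, ereal z)) \<in> measurable (?M1 \<Otimes>\<^sub>M ?M2) (borel_of_top upper_plane)"
    using real_to_upper_plane_measurable by (simp cong: measurable_cong_sets)
  have "emeasure (mu_hat \<gamma>) B =
      emeasure (?M1 \<Otimes>\<^sub>M ?M2) ((\<lambda>(x, z). (ereal x, ereal z)) -` B \<inter> space (?M1 \<Otimes>\<^sub>M ?M2))"
    unfolding mu_hat_def by (rule emeasure_distr[OF \<iota> assms(2)])
  also have "(\<lambda>(x, z). (ereal x, ereal z)) -` B \<inter> space (?M1 \<Otimes>\<^sub>M ?M2) = S \<times> T"
    using assms(5) by (auto simp: space_pair_measure)
  also have "emeasure (?M1 \<Otimes>\<^sub>M ?M2) (S \<times> T) = emeasure ?M1 S * emeasure ?M2 T"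
    by (rule M2.emeasure_pair_measure_Times) (use assms in auto)
  finally show ?thesis .
qed

lemma mu_hat_half_strip_unbounded:
  assumes "\<gamma> > 0"
  shows "emeasure (mu_hat \<gamma>) (half_strip a (ereal b) \<infinity>) = ennreal (exp (- a) * exp (- \<gamma> * b))"
proof -
  have "emeasure (mu_hat \<gamma>) (half_strip a (ereal b) \<infinity>) =
      emeasure (density lborel (\<lambda>x. ennreal (exp (- x)))) {a<..} *
      emeasure (density lborel (\<lambda>z. ennreal (\<gamma> * exp (- \<gamma> * z)))) {b<..}"
    by (rule emeasure_mu_hat_Times[OF assms half_strip_sets]) (auto simp: half_strip_def)
  thus ?thesis
    using emeasure_exponential_density_greaterThan[OF assms, of b]
      emeasure_exponential_density_greaterThan[of 1 a] by (simp add: ennreal_mult)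
qed

lemma mu_hat_half_strip:
  assumes "\<gamma> > 0" "b \<le> d"
  shows "emeasure (mu_hat \<gamma>) (half_strip a (ereal b) (ereal d)) =
    ennreal (exp (- a) * (exp (- \<gamma> * b) - exp (- \<gamma> * d)))"
proof -
  have "half_strip a (ereal b) (ereal d) = half_strip a (ereal b) \<infinity> - half_strip a (ereal d) \<infinity>"
    by (auto simp: half_strip_def not_less)
  also have "emeasure (mu_hat \<gamma>) \<dots> = emeasure (mu_hat \<gamma>) (half_strip a (ereal b) \<infinity>) -
      emeasure (mu_hat \<gamma>) (half_strip a (ereal d) \<infinity>)"
  proof (rule emeasure_Diff)
    show "half_strip a (ereal d) \<infinity> \<subseteq> half_strip a (ereal b) \<infinity>"
      using assms(2) by (intro half_strip_mono) auto
  qed (use assms in \<open>auto simp: mu_hat_half_strip_unbounded half_strip_sets\<close>)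
  also have "\<dots> = ennreal (exp (- a) * (exp (- \<gamma> * b) - exp (- \<gamma> * d)))"
    using assms by (simp add: mu_hat_half_strip_unbounded ennreal_minus algebra_simps)
  finally show ?thesis .
qed

definition at_infinity_set :: "(ereal \<times> ereal) set" where
  "at_infinity_set = {p \<in> {- \<infinity> <..} \<times> {- \<infinity> <..}. fst p = \<infinity> \<or> snd p = \<infinity>}"

lemma at_infinity_set_sets: "at_infinity_set \<in> sets (borel_of_top upper_plane)"
proof (rule sets_upper_planeI)
  have "at_infinity_set = {\<infinity>} \<times> {- \<infinity> <..} \<union> {- \<infinity> <..} \<times> {\<infinity>}"
  proof (rule set_eqI)
    fix p :: "ereal \<times> ereal"
    show "p \<in> at_infinity_set \<longleftrightarrow> p \<in> {\<infinity>} \<times> {- \<infinity> <..} \<union> {- \<infinity> <..} \<times> {\<infinity>}"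
      by (cases p, cases "fst p"; cases "snd p") (simp_all add: at_infinity_set_def)
  qed
  also have "\<dots> \<in> sets (borel \<Otimes>\<^sub>M borel)" by simp
  finally show "at_infinity_set \<in> sets borel" by (simp only: borel_prod)
qed (auto simp: at_infinity_set_def)

lemma mu_hat_at_infinity:
  assumes "\<gamma> > 0"
  shows "emeasure (mu_hat \<gamma>) at_infinity_set = 0"
  by (subst emeasure_mu_hat_Times[OF assms at_infinity_set_sets, of "{}" "{}"])
     (auto simp: at_infinity_set_def)

section \<open>Simple configurations\<close>

abbreviation plane_point :: "real \<times> real \<Rightarrow> ereal \<times> ereal" where
  "plane_point p \<equiv> (ereal (fst p), ereal (snd p))"

text \<open>
  On \<open>W\<close> the measure is a finite sum of unit masses. Distinctness of the ordinates is part of the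
  notion because the coupling recovers a point from the horizontal strip that contains it.
\<close>

definition simple_on :: "(ereal \<times> ereal) measure \<Rightarrow> (ereal \<times> ereal) set \<Rightarrow> (real \<times> real) set \<Rightarrow> bool"
  where "simple_on \<nu> W A \<longleftrightarrow> finite A \<and> inj_on snd A \<and> plane_point ` A \<subseteq> W \<and>
    (\<forall>B \<in> sets (borel_of_top upper_plane). B \<subseteq> W \<longrightarrow>
      emeasure \<nu> B = of_nat (card {p \<in> A. plane_point p \<in> B}))"

text \<open>
  Integrality on a basis yields finitely many atoms that carry all the mass. A multiple atom, or two
  atoms with the same ordinate, would give mass at least 2 to one of the horizontal strips into
  which \<open>W\<close> is cut.
\<close>

lemma simple_onI:
  fixes B :: "(ereal \<times> ereal) set set" and C :: "nat \<Rightarrow> ereal" and a :: real and b :: ereal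
  defines "W \<equiv> half_strip a b \<infinity>"
  assumes sets: "sets \<nu> = sets (borel_of_top upper_plane)"
    and B: "countable B" "topological_basis B"
    and finite: "emeasure \<nu> W < \<infinity>"
    and nat: "\<And>u. u \<in> B \<Longrightarrow> \<exists>k::nat. emeasure \<nu> (u \<inter> W) = of_nat k"
    and inf: "emeasure \<nu> at_infinity_set = 0"
    and C: "C 0 = \<infinity>" "C m = b"
    and strips: "\<And>j. j < m \<Longrightarrow> emeasure \<nu> (half_strip a (C (Suc j)) (C j)) \<le> 1"
  obtains A where "simple_on \<nu> W A"
proof -
  have W_open: "open W" unfolding W_def by (rule open_half_strip_unbounded)
  have W_sub: "W \<subseteq> {- \<infinity> <..} \<times> {- \<infinity> <..}"
    unfolding W_def by (rule half_strip_subset_upper_plane)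
  have open_sets: "U \<in> sets \<nu>" if "open U" "U \<subseteq> W" for U
    unfolding sets using that W_sub by (intro sets_upper_planeI) auto
  have jump: "emeasure \<nu> (u \<inter> W) = 0 \<or> emeasure \<nu> (u \<inter> W) \<ge> 1" if "u \<in> B" for u
  proof -
    obtain k :: nat where "emeasure \<nu> (u \<inter> W) = of_nat k" using nat \<open>u \<in> B\<close> by blast
    thus ?thesis by (cases k) auto
  qed
  obtain A where A: "finite A" "A \<subseteq> W" "emeasure \<nu> (W - A) = 0"
    "\<And>p. p \<in> A \<Longrightarrow> {p} \<in> sets \<nu> \<and> emeasure \<nu> {p} \<ge> 1"
    by (rule finitely_many_atoms[OF B W_open finite open_sets jump]) blast+
  have W_sets: "W \<in> sets \<nu>"
    unfolding W_def sets by (rule half_strip_sets)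
  have strip: "\<exists>j<m. C (Suc j) < snd p \<and> snd p \<le> C j" if "p \<in> W" for p
  proof -
    have "\<not> \<not> snd p \<le> C 0" "\<not> snd p \<le> C m"
      using that C by (auto simp: W_def half_strip_def)
    hence "\<exists>k<m. (\<forall>i\<le>k. \<not> \<not> snd p \<le> C i) \<and> \<not> snd p \<le> C (Suc k)"
      by (intro ex_least_nat_less[where P = "\<lambda>i. \<not> snd p \<le> C i"]) auto
    thus ?thesis by (meson not_le order_refl)
  qed
  have small: "emeasure \<nu> S \<le> 1"
    if "S \<subseteq> A" "p \<in> S" "\<And>q. q \<in> S \<Longrightarrow> snd q = snd p" for S p
  proof -
    have "p \<in> W" using that A(2) by blast
    then obtain j where j: "j < m" "C (Suc j) < snd p" "snd p \<le> C j"
      using strip by blast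
    have "S \<subseteq> half_strip a (C (Suc j)) (C j)"
    proof
      fix q assume q: "q \<in> S"
      hence "q \<in> W" using that A(2) by auto
      thus "q \<in> half_strip a (C (Suc j)) (C j)"
        using that(3)[OF q] j by (cases q) (auto simp: W_def half_strip_def)
    qed
    hence "emeasure \<nu> S \<le> emeasure \<nu> (half_strip a (C (Suc j)) (C j))"
      by (rule emeasure_mono) (simp add: sets half_strip_sets)
    also have "\<dots> \<le> 1" using strips j(1) .
    finally show ?thesis .
  qed
  have unit: "emeasure \<nu> {p} = 1" if "p \<in> A" for p
    using small[of "{p}" p] A(4)[OF that] that by (intro antisym) auto
  have inj: "inj_on snd A"
  proof (rule inj_onI, rule ccontr)
    fix p q assume pq: "p \<in> A" "q \<in> A" "snd p = snd q" "p \<noteq> q"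
    have "emeasure \<nu> {p, q} = (\<Sum>x\<in>{p, q}. emeasure \<nu> {x})"
      by (rule emeasure_eq_sum_singleton) (use pq A in auto)
    also have "\<dots> = 2" using pq unit by simp
    finally show False using small[of "{p, q}" p] pq by auto
  qed
  have real: "\<exists>x z. p = (ereal x, ereal z)" if "p \<in> A" for p
  proof -
    have "p \<notin> at_infinity_set"
    proof
      assume "p \<in> at_infinity_set"
      hence "emeasure \<nu> {p} \<le> emeasure \<nu> at_infinity_set"
        by (intro emeasure_mono) (auto simp: sets at_infinity_set_sets)
      thus False using unit[OF that] inf by simp
    qed
    moreover have "p \<in> {- \<infinity> <..} \<times> {- \<infinity> <..}" using that A(2) W_sub by blast
    ultimately have "\<bar>fst p\<bar> \<noteq> \<infinity>" "\<bar>snd p\<bar> \<noteq> \<infinity>"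
      by (auto simp: at_infinity_set_def)
    thus ?thesis
      by (intro exI[of _ "real_of_ereal (fst p)"] exI[of _ "real_of_ereal (snd p)"])
         (auto simp: ereal_real)
  qed
  define \<iota> where "\<iota> = plane_point"
  define A' where "A' = \<iota> -` A"
  have inj_\<iota>: "inj \<iota>" by (auto simp: \<iota>_def inj_def)
  have card: "emeasure \<nu> S = of_nat (card {p \<in> A'. \<iota> p \<in> S})"
    if S: "S \<in> sets (borel_of_top upper_plane)" "S \<subseteq> W" for S
  proof -
    have A_sub: "S' \<in> sets \<nu>" if "S' \<subseteq> A" for S'
      by (rule sets.countable[OF _ countable_finite]) (use that A finite_subset in auto)
    have null: "S - A \<in> null_sets \<nu>"
    proof (rule null_sets_subset)
      show "W - A \<in> null_sets \<nu>" using A W_sets A_sub by auto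
    qed (use S sets A_sub in auto)
    have "emeasure \<nu> S = emeasure \<nu> (S \<inter> A \<union> (S - A))" by (simp add: Int_Diff_Un)
    also have "\<dots> = emeasure \<nu> (S \<inter> A)"
      by (rule emeasure_Un_null_set) (use null A_sub in auto)
    also have "\<dots> = (\<Sum>x\<in>S \<inter> A. emeasure \<nu> {x})"
      by (rule emeasure_eq_sum_singleton) (use A in auto)
    also have "\<dots> = of_nat (card (S \<inter> A))" using unit by simp
    also have "S \<inter> A = \<iota> ` {p \<in> A'. \<iota> p \<in> S}"
    proof (intro equalityI subsetI)
      fix p assume p: "p \<in> S \<inter> A"
      then obtain x z where "p = \<iota> (x, z)" using real[of p] by (auto simp: \<iota>_def)
      thus "p \<in> \<iota> ` {p \<in> A'. \<iota> p \<in> S}" using p by (auto simp: A'_def)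
    qed (auto simp: A'_def)
    also have "card \<dots> = card {p \<in> A'. \<iota> p \<in> S}"
      by (rule card_image) (use inj_\<iota> in \<open>auto intro: inj_on_subset\<close>)
    finally show ?thesis .
  qed
  have "inj_on snd A'"
  proof (rule inj_onI)
    fix p q assume pq: "p \<in> A'" "q \<in> A'" "snd p = snd q"
    hence "\<iota> p = \<iota> q"
      using inj_onD[OF inj, of "\<iota> p" "\<iota> q"] by (auto simp: A'_def \<iota>_def)
    thus "p = q" using inj_\<iota> by (auto dest: injD)
  qed
  moreover have "finite A'"
    unfolding A'_def by (rule finite_vimageI[OF A(1) inj_\<iota>])
  moreover have "\<iota> ` A' \<subseteq> W" using A(2) by (auto simp: A'_def)
  ultimately have "simple_on \<nu> W A'"
    using card unfolding simple_on_def \<iota>_def by blast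
  thus thesis by (rule that)
qed

section \<open>Almost sure properties of the Poisson process\<close>

lemma (in prob_space) AE_notin_of_prob_tendsto_0:
  assumes E: "\<And>m::nat. E m \<in> events" and lim: "(\<lambda>m. prob (E m)) \<longlonglongrightarrow> 0"
  shows "AE \<omega> in M. \<exists>m\<ge>m0. \<omega> \<notin> E m"
proof (rule AE_I)
  have sets: "(\<Inter>m\<in>{m0..}. E m) \<in> events" using E by auto
  have "prob (\<Inter>m\<in>{m0..}. E m) \<le> 0"
  proof (rule LIMSEQ_le_const[OF lim], intro exI allI impI)
    fix m assume "m0 \<le> m"
    thus "prob (\<Inter>m\<in>{m0..}. E m) \<le> prob (E m)"
      using E by (intro finite_measure_mono) auto
  qed
  thus "emeasure M (\<Inter>m\<in>{m0..}. E m) = 0"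
    by (simp add: emeasure_eq_measure measure_le_0_iff)
  show "{\<omega> \<in> space M. \<not> (\<exists>m\<ge>m0. \<omega> \<notin> E m)} \<subseteq> (\<Inter>m\<in>{m0..}. E m)" by auto
  show "(\<Inter>m\<in>{m0..}. E m) \<in> events" by (rule sets)
qed

locale poisson_on_plane = prob_space N for N :: "'v measure" +
  fixes \<gamma> :: real and \<xi> :: "'v \<Rightarrow> (ereal \<times> ereal) measure"
  assumes \<gamma>: "\<gamma> > 0" and poisson: "poisson_point_process upper_plane (mu_hat \<gamma>) N \<xi>"
begin

lemma random_element_xi: "random_element N (vague_topology upper_plane) \<xi>"
  using poisson by (simp add: poisson_point_process_def)

lemma xi_radon:
  assumes "\<omega> \<in> space N"
  shows "\<xi> \<omega> \<in> radon_measures upper_plane"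
  using measurable_space[OF random_element_xi[unfolded random_element_def] assms] by simp

lemma sets_xi: "\<omega> \<in> space N \<Longrightarrow> sets (\<xi> \<omega>) = sets (borel_of_top upper_plane)"
  using xi_radon[of \<omega>] by (simp add: radon_measures_def)

lemma indep_counts:
  fixes m :: nat
  assumes "\<And>j. j < m \<Longrightarrow> B j \<in> sets (borel_of_top upper_plane)" "disjoint_family_on B {..<m}"
  shows "indep_vars (\<lambda>_. borel) (\<lambda>j \<omega>. emeasure (\<xi> \<omega>) (B j)) {..<m}"
  using poisson assms unfolding poisson_point_process_def by blast

lemma measurable_count [measurable]:
  assumes "B \<in> sets (borel_of_top upper_plane)"
  shows "(\<lambda>\<omega>. emeasure (\<xi> \<omega>) B) \<in> borel_measurable N"
proof -
  have "indep_vars (\<lambda>_. borel) (\<lambda>j \<omega>. emeasure (\<xi> \<omega>) B) {..<Suc 0}"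
    by (rule indep_counts) (use assms in \<open>auto simp: disjoint_family_on_def\<close>)
  thus ?thesis by (auto simp: indep_vars_def)
qed

lemma prob_count:
  assumes "B \<in> sets (borel_of_top upper_plane)" "emeasure (mu_hat \<gamma>) B = ennreal r" "r \<ge> 0"
  shows "prob {\<omega> \<in> space N. emeasure (\<xi> \<omega>) B = of_nat k} = exp (- r) * r ^ k / fact k"
proof -
  have "measure (mu_hat \<gamma>) B = r" using assms by (simp add: measure_def)
  thus ?thesis
    using poisson assms unfolding poisson_point_process_def by auto
qed

lemma prob_count_0:
  assumes "B \<in> sets (borel_of_top upper_plane)" "emeasure (mu_hat \<gamma>) B = ennreal r" "r \<ge> 0"
  shows "prob {\<omega> \<in> space N. emeasure (\<xi> \<omega>) B = 0} = exp (- r)"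
  using prob_count[OF assms, of 0] by simp

lemma AE_count_eq_0:
  assumes "B \<in> sets (borel_of_top upper_plane)" "emeasure (mu_hat \<gamma>) B = 0"
  shows "AE \<omega> in N. emeasure (\<xi> \<omega>) B = 0"
proof -
  have "prob {\<omega> \<in> space N. emeasure (\<xi> \<omega>) B = 0} = 1"
    using prob_count_0[OF assms(1), of 0] assms by simp
  thus ?thesis
    by (subst (asm) prob_Collect_eq_1) (use assms in measurable)
qed

text \<open>
  The Poisson weights add up to 1. The values of \<open>\<xi>\<close> are a priori just Radon measures; integrality
  on a countable basis is what makes them configurations of points.
\<close>

lemma AE_count_nat:
  assumes B: "B \<in> sets (borel_of_top upper_plane)" and fin: "emeasure (mu_hat \<gamma>) B < \<infinity>"
  shows "AE \<omega> in N. \<exists>k::nat. emeasure (\<xi> \<omega>) B = of_nat k"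
proof -
  note [measurable] = B
  obtain r where r: "emeasure (mu_hat \<gamma>) B = ennreal r" "r \<ge> 0"
    using fin by (cases "emeasure (mu_hat \<gamma>) B") auto
  define E where "E k = {\<omega> \<in> space N. emeasure (\<xi> \<omega>) B = of_nat k}" for k :: nat
  have E: "E k \<in> events" for k unfolding E_def by measurable
  have "(\<lambda>k. prob (E k)) sums prob (\<Union>k. E k)"
    by (rule finite_measure_UNION) (use E in \<open>auto simp: E_def disjoint_family_on_def\<close>)
  moreover have "(\<lambda>k. prob (E k)) sums (exp (- r) * exp r)"
  proof -
    have "prob (E k) = exp (- r) * (r ^ k /\<^sub>R fact k)" for k
      using prob_count[OF B r, of k] by (simp add: E_def divide_inverse)
    thus ?thesis using sums_mult[OF exp_converges[of r]] by simp
  qed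
  ultimately have "prob (\<Union>k. E k) = 1"
    using sums_unique2 by (simp add: exp_minus) blast
  hence "AE \<omega> in N. \<omega> \<in> (\<Union>k. E k)"
    using E by (intro AE_prob_1) auto
  thus ?thesis by eventually_elim (auto simp: E_def)
qed

lemma prob_count_notin_0_1:
  assumes B: "B \<in> sets (borel_of_top upper_plane)" and r: "emeasure (mu_hat \<gamma>) B = ennreal r" "r \<ge> 0"
  shows "prob {\<omega> \<in> space N. \<not> (emeasure (\<xi> \<omega>) B = 0 \<or> emeasure (\<xi> \<omega>) B = 1)} \<le> r\<^sup>2"
proof -
  note [measurable] = B
  let ?E = "\<lambda>k::nat. {\<omega> \<in> space N. emeasure (\<xi> \<omega>) B = of_nat k}"
  have E: "?E k \<in> events" for k by measurable
  have "{\<omega> \<in> space N. \<not> (emeasure (\<xi> \<omega>) B = 0 \<or> emeasure (\<xi> \<omega>) B = 1)} = space N - (?E 0 \<union> ?E 1)"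
    by auto
  also have "prob \<dots> = 1 - prob (?E 0 \<union> ?E 1)"
    by (rule prob_compl) (use E in blast)
  also have "prob (?E 0 \<union> ?E 1) = prob (?E 0) + prob (?E 1)"
    by (rule finite_measure_Union) (use E[of 0] E[of 1] in auto)
  also have "\<dots> = exp (- r) * (1 + r)"
    using prob_count[OF B r, of 0] prob_count[OF B r, of 1] by (simp add: algebra_simps)
  also have "1 - \<dots> \<le> 1 - (1 - r) * (1 + r)"
    using exp_ge_add_one_self[of "- r"] r(2)
    by (intro diff_left_mono mult_right_mono) auto
  also have "\<dots> = r\<^sup>2" by (simp add: power2_eq_square algebra_simps)
  finally show ?thesis .
qed

lemma half_strip_mean:
  assumes "b \<le> d"
  shows "emeasure (mu_hat \<gamma>) (half_strip a (ereal b) (ereal d)) =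
    ennreal (exp (- a) * (exp (- \<gamma> * b) - exp (- \<gamma> * d)))"
    "exp (- a) * (exp (- \<gamma> * b) - exp (- \<gamma> * d)) \<ge> 0"
  using mu_hat_half_strip[OF \<gamma> assms] assms \<gamma> by auto

text \<open>
  Cutting a half strip of mean mass \<open>r\<close> into \<open>m\<close> horizontal strips of mean mass \<open>r / m\<close>, some strip
  has two points or more with probability at most \<open>m * (r / m)\<^sup>2\<close>, which is
  small for large \<open>m\<close>.
\<close>

lemma AE_some_partition_separates:
  "AE \<omega> in N. \<exists>C (m::nat). C 0 = \<infinity> \<and> C m = ereal b \<and>
     (\<forall>j<m. emeasure (\<xi> \<omega>) (half_strip a (C (Suc j)) (C j)) \<le> 1)"
proof -
  define C :: "nat \<Rightarrow> nat \<Rightarrow> ereal"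
    where "C m j = (if j = 0 then \<infinity> else ereal (b - ln (real j / real m) / \<gamma>))" for m j
  define r where "r = exp (- a) * exp (- \<gamma> * b)"
  have mass: "emeasure (mu_hat \<gamma>) (half_strip a (C m (Suc j)) (C m j)) = ennreal (r / real m)"
    if "j < m" for m j
  proof -
    have e: "exp (- \<gamma> * (b - ln (real i / real m) / \<gamma>)) = exp (- \<gamma> * b) * (real i / real m)"
      if "i > 0" for i
    proof -
      have "- \<gamma> * (b - ln (real i / real m) / \<gamma>) = - \<gamma> * b + ln (real i / real m)"
        using \<gamma> by (simp add: field_simps)
      moreover have "real i / real m > 0" using that \<open>j < m\<close> by simp
      ultimately show ?thesis by (simp only: exp_add exp_ln)
    qed
    show ?thesis
    proof (cases "j = 0")
      case True
      hence "emeasure (mu_hat \<gamma>) (half_strip a (C m (Suc j)) (C m j)) =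
          ennreal (exp (- a) * exp (- \<gamma> * (b - ln (real (Suc j) / real m) / \<gamma>)))"
        using mu_hat_half_strip_unbounded[OF \<gamma>] by (simp add: C_def)
      thus ?thesis using True e[of "Suc j"] by (simp add: r_def)
    next
      case False
      have "ln (real j / real m) \<le> ln (real (Suc j) / real m)"
        using False that by (intro ln_mono divide_right_mono) auto
      hence "b - ln (real (Suc j) / real m) / \<gamma> \<le> b - ln (real j / real m) / \<gamma>"
        using \<gamma> by (simp add: divide_right_mono)
      hence "emeasure (mu_hat \<gamma>) (half_strip a (C m (Suc j)) (C m j)) = ennreal (exp (- a) *
          (exp (- \<gamma> * (b - ln (real (Suc j) / real m) / \<gamma>)) -
           exp (- \<gamma> * (b - ln (real j / real m) / \<gamma>))))"
        using mu_hat_half_strip[OF \<gamma>] False by (simp add: C_def)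
      also have "\<dots> = ennreal (r / real m)"
        unfolding e[OF zero_less_Suc] e[OF False[unfolded neq0_conv]]
        by (simp add: r_def flip: right_diff_distrib diff_divide_distrib)
      finally show ?thesis .
    qed
  qed
  define E where "E m j = {\<omega> \<in> space N.
    \<not> (emeasure (\<xi> \<omega>) (half_strip a (C m (Suc j)) (C m j)) = 0 \<or>
       emeasure (\<xi> \<omega>) (half_strip a (C m (Suc j)) (C m j)) = 1)}" for m j
  have [measurable]: "half_strip a (C m i) (C m j) \<in> sets (borel_of_top upper_plane)" for m i j
    by (rule half_strip_sets)
  have E: "E m j \<in> events" for m j unfolding E_def by measurable
  have r: "r \<ge> 0" by (simp add: r_def)
  have prob_le: "prob (\<Union>j<m. E m j) \<le> r\<^sup>2 / real m" for m
  proof -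
    have "prob (\<Union>j<m. E m j) \<le> (\<Sum>j<m. prob (E m j))"
      using E by (intro finite_measure_subadditive_finite) auto
    also have "\<dots> \<le> (\<Sum>j<m. (r / real m)\<^sup>2)"
      unfolding E_def using r mass by (intro sum_mono prob_count_notin_0_1) auto
    also have "\<dots> = r\<^sup>2 / real m" by (simp add: power2_eq_square)
    finally show ?thesis .
  qed
  have "(\<lambda>m. prob (\<Union>j<m. E m j)) \<longlonglongrightarrow> 0"
  proof (rule tendsto_sandwich[where f = "\<lambda>_. 0" and h = "\<lambda>m. r\<^sup>2 / real m"])
    show "(\<lambda>m. r\<^sup>2 / real m) \<longlonglongrightarrow> 0" by real_asymp
    show "\<forall>\<^sub>F m in sequentially. prob (\<Union>j<m. E m j) \<le> r\<^sup>2 / real m"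
      by (intro always_eventually allI prob_le)
  qed auto
  hence "AE \<omega> in N. \<exists>m\<ge>1. \<omega> \<notin> (\<Union>j<m. E m j)"
    using E by (intro AE_notin_of_prob_tendsto_0) auto
  with AE_space show ?thesis
  proof eventually_elim
    case (elim \<omega>)
    then obtain m where m: "m \<ge> 1" "\<omega> \<notin> (\<Union>j<m. E m j)" by blast
    have "emeasure (\<xi> \<omega>) (half_strip a (C m (Suc j)) (C m j)) \<le> 1" if "j < m" for j
    proof -
      have "\<omega> \<notin> E m j" using m(2) that by blast
      hence "emeasure (\<xi> \<omega>) (half_strip a (C m (Suc j)) (C m j)) = 0 \<or>
          emeasure (\<xi> \<omega>) (half_strip a (C m (Suc j)) (C m j)) = 1"
        using elim(1) by (simp add: E_def)
      thus ?thesis by auto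
    qed
    moreover have "C m 0 = \<infinity>" "C m m = ereal b" using m(1) by (auto simp: C_def)
    ultimately show ?case by blast
  qed
qed

text \<open>
  A countable basis reduces integrality to countably many sets, so a single null set can be
  discarded.
\<close>

lemma AE_simple: "AE \<omega> in N. \<forall>a::nat. \<exists>A. simple_on (\<xi> \<omega>) (half_strip (- real a) (ereal (- real a)) \<infinity>) A"
proof -
  obtain B :: "(ereal \<times> ereal) set set" where B: "countable B" "topological_basis B"
    using ex_countable_basis by blast
  have "AE \<omega> in N. \<exists>A. simple_on (\<xi> \<omega>) (half_strip a (ereal b) \<infinity>) A" for a b
  proof -
    let ?W = "half_strip a (ereal b) \<infinity>"
    have W: "?W \<in> sets (borel_of_top upper_plane)" by (rule half_strip_sets)
    have uW: "u \<inter> ?W \<in> sets (borel_of_top upper_plane)" if "u \<in> B" for u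
      using topological_basis_open[OF B(2) that] half_strip_subset_upper_plane
      by (intro sets_upper_planeI) (auto intro!: borel_open open_Int open_half_strip_unbounded)
    have "AE \<omega> in N. \<exists>k::nat. emeasure (\<xi> \<omega>) (u \<inter> ?W) = of_nat k" if "u \<in> B" for u
    proof (rule AE_count_nat[OF uW[OF that]])
      have "emeasure (mu_hat \<gamma>) (u \<inter> ?W) \<le> emeasure (mu_hat \<gamma>) ?W"
        using W by (intro emeasure_mono) auto
      thus "emeasure (mu_hat \<gamma>) (u \<inter> ?W) < \<infinity>"
        by (auto simp: mu_hat_half_strip_unbounded[OF \<gamma>] intro: le_less_trans)
    qed
    hence 1: "AE \<omega> in N. \<forall>u\<in>B. \<exists>k::nat. emeasure (\<xi> \<omega>) (u \<inter> ?W) = of_nat k"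
      by (subst AE_ball_countable[OF B(1)]) auto
    have 2: "AE \<omega> in N. \<exists>k::nat. emeasure (\<xi> \<omega>) ?W = of_nat k"
      by (rule AE_count_nat[OF W]) (simp add: mu_hat_half_strip_unbounded[OF \<gamma>])
    have 3: "AE \<omega> in N. emeasure (\<xi> \<omega>) at_infinity_set = 0"
      by (rule AE_count_eq_0[OF at_infinity_set_sets mu_hat_at_infinity[OF \<gamma>]])
    show ?thesis
      using 1 2 3 AE_some_partition_separates[of b a] AE_space
    proof eventually_elim
      case (elim \<omega>)
      then obtain C m where C: "C 0 = \<infinity>" "C m = ereal b"
        "\<And>j. j < m \<Longrightarrow> emeasure (\<xi> \<omega>) (half_strip a (C (Suc j)) (C j)) \<le> 1"
        by blast
      have fin: "emeasure (\<xi> \<omega>) ?W < \<infinity>" using elim(2) by (auto simp: of_nat_less_top)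
      have nat: "\<exists>k::nat. emeasure (\<xi> \<omega>) (u \<inter> ?W) = of_nat k" if "u \<in> B" for u
        using elim(1) that by blast
      show ?case
        by (rule simple_onI[OF sets_xi[OF elim(5)] B fin nat elim(3) C]) blast+
    qed
  qed
  thus ?thesis by (subst AE_all_countable) auto
qed

text \<open>
  The part of a strip to the right of \<open>- k\<close> has mean mass proportional to \<open>exp k\<close> and is therefore
  empty with a probability that tends to 0. So every strip has a largest abscissa, which the
  coupling needs as it places one point for every index.
\<close>

lemma AE_strips_nonempty:
  "AE \<omega> in N. \<forall>n\<ge>2. \<forall>j. \<exists>t. emeasure (\<xi> \<omega>) (half_strip t (ordinate n (Suc j)) (ordinate n j)) \<noteq> 0"
proof -
  have "AE \<omega> in N. n \<ge> 2 \<longrightarrow> (\<exists>t. emeasure (\<xi> \<omega>) (half_strip t (ordinate n (Suc j)) (ordinate n j)) \<noteq> 0)"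
    for n j
  proof (cases "n \<ge> 2")
    case True
    have [measurable]: "half_strip t (ordinate n (Suc j)) (ordinate n j) \<in> sets (borel_of_top upper_plane)"
      for t by (rule half_strip_sets)
    define E where "E k = {\<omega> \<in> space N.
      emeasure (\<xi> \<omega>) (half_strip (- real k) (ordinate n (Suc j)) (ordinate n j)) = 0}" for k
    have E: "E k \<in> events" for k unfolding E_def by measurable
    have "ordinate n (Suc j) \<le> ordinate n j"
      using ordinate_less[OF True, of j "Suc j"] by simp
    hence "prob (E k) = exp (- (exp (real k) * strip_mass \<gamma> n j))" for k
      unfolding E_def strip_mass_def
      using half_strip_mean[of "ordinate n (Suc j)" "ordinate n j" "- real k"]
      by (subst prob_count_0[where r = "exp (real k) *
            (exp (- \<gamma> * ordinate n (Suc j)) - exp (- \<gamma> * ordinate n j))"]) auto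
    moreover have "(\<lambda>k. exp (- (exp (real k) * strip_mass \<gamma> n j))) \<longlonglongrightarrow> 0"
      using strip_mass_pos[OF \<gamma> True, of j] by real_asymp
    ultimately have "(\<lambda>k. prob (E k)) \<longlonglongrightarrow> 0" by simp
    from AE_notin_of_prob_tendsto_0[OF E this, of 0] AE_space show ?thesis
      by eventually_elim (auto simp: E_def)
  qed auto
  thus ?thesis by (simp add: AE_all_countable)
qed

end

section \<open>The coupled process and its almost sure convergence\<close>

abbreviation strip_count :: "(ereal \<times> ereal) measure \<Rightarrow> nat \<Rightarrow> nat \<Rightarrow> real \<Rightarrow> ennreal" where
  "strip_count \<nu> n j t \<equiv> emeasure \<nu> (half_strip t (ordinate n (Suc j)) (ordinate n j))"

text \<open>
  The largest abscissa in a strip. The default value covers strips that are empty and strips whose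
  abscissas are unbounded above, neither of which occurs almost surely.
\<close>

definition strip_max :: "(ereal \<times> ereal) measure \<Rightarrow> nat \<Rightarrow> nat \<Rightarrow> real" where
  "strip_max \<nu> n j = (if (\<exists>t. strip_count \<nu> n j t = 0) \<and> (\<exists>t. strip_count \<nu> n j t \<noteq> 0)
     then Inf {t. strip_count \<nu> n j t = 0} else 0)"

lemma strip_count_eq_0_mono:
  assumes "sets \<nu> = sets (borel_of_top upper_plane)" "s \<le> t" "strip_count \<nu> n j s = 0"
  shows "strip_count \<nu> n j t = 0"
proof -
  have "strip_count \<nu> n j t \<le> strip_count \<nu> n j s"
  proof (rule emeasure_mono)
    show "half_strip t (ordinate n (Suc j)) (ordinate n j)
        \<subseteq> half_strip s (ordinate n (Suc j)) (ordinate n j)"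
      using assms(2) by (intro half_strip_mono) auto
  qed (simp add: assms half_strip_sets)
  thus ?thesis using assms(3) by simp
qed

lemma strip_max_le_iff:
  assumes sets: "sets \<nu> = sets (borel_of_top upper_plane)"
    and ex: "\<exists>t. strip_count \<nu> n j t = 0" "\<exists>t. strip_count \<nu> n j t \<noteq> 0"
  shows "strip_max \<nu> n j \<le> t \<longleftrightarrow> strip_count \<nu> n j t = 0"
proof -
  define S where "S = {t. strip_count \<nu> n j t = 0}"
  have up: "t \<in> S" if "s \<in> S" "s \<le> t" for s t
    using strip_count_eq_0_mono[OF sets that(2)] that(1) by (auto simp: S_def)
  obtain s where s: "s \<notin> S" using ex(2) by (auto simp: S_def)
  have S: "S \<noteq> {}" using ex(1) by (auto simp: S_def)
  have bdd: "bdd_below S"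
    by (rule bdd_belowI[of _ s]) (use s up in \<open>meson linear\<close>)
  have max: "strip_max \<nu> n j = Inf S" using ex by (simp add: strip_max_def S_def)
  have "Inf S \<in> S"
  proof -
    let ?H = "\<lambda>k::nat. half_strip (Inf S + inverse (real (Suc k))) (ordinate n (Suc j)) (ordinate n j)"
    have "?H k \<in> null_sets \<nu>" for k
    proof -
      have "Inf S < Inf S + inverse (real (Suc k))" by simp
      then obtain u where "u \<in> S" "u < Inf S + inverse (real (Suc k))"
        using cInf_less_iff[OF S bdd] by blast
      hence "Inf S + inverse (real (Suc k)) \<in> S" using up by (meson less_imp_le)
      thus ?thesis by (auto simp: S_def sets half_strip_sets)
    qed
    hence "(\<Union>k. ?H k) \<in> null_sets \<nu>" by auto
    moreover have "half_strip (Inf S) (ordinate n (Suc j)) (ordinate n j) \<subseteq> (\<Union>k. ?H k)"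
    proof
      fix p assume p: "p \<in> half_strip (Inf S) (ordinate n (Suc j)) (ordinate n j)"
      then obtain y where y: "ereal (Inf S) < ereal y" "ereal y < fst p"
        using ereal_dense2[of "ereal (Inf S)" "fst p"] by (auto simp: half_strip_def)
      then obtain k where "inverse (real (Suc k)) < y - Inf S"
        using reals_Archimedean[of "y - Inf S"] by auto
      hence "ereal (Inf S + inverse (real (Suc k))) < ereal y" by simp
      hence "ereal (Inf S + inverse (real (Suc k))) < fst p" using y(2) by (rule less_trans)
      thus "p \<in> (\<Union>k. ?H k)" using p by (cases p) (auto simp: half_strip_def)
    qed
    ultimately have "strip_count \<nu> n j (Inf S) = 0"
      using emeasure_mono[of _ "\<Union>k. ?H k" \<nu>] by (auto simp: null_sets_def)
    thus ?thesis by (simp add: S_def)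
  qed
  hence "Inf S \<le> t \<longleftrightarrow> t \<in> S" using up cInf_lower[OF _ bdd] by blast
  thus ?thesis by (simp add: max S_def)
qed

lemma strip_index_unique:
  assumes "n \<ge> 2" "ordinate n (Suc i) < z" "z \<le> ordinate n i"
    "ordinate n (Suc j) < z" "z \<le> ordinate n j"
  shows "i = j"
proof (rule ccontr)
  have ord: "ordinate n l \<le> ordinate n k" if "k \<le> l" for k l
    using ordinate_less[OF assms(1), of k l] that by (cases "k = l") auto
  assume "i \<noteq> j"
  hence "Suc i \<le> j \<or> Suc j \<le> i" by linarith
  thus False using ord[of "Suc i" j] ord[of "Suc j" i] assms by linarith
qed

lemma simple_on_strip_empty:
  assumes "simple_on \<nu> (half_strip (- real a) (ereal (- real a)) \<infinity>) A"
    and "- real a \<le> ordinate n (Suc j)"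
  shows "\<exists>t. strip_count \<nu> n j t = 0"
proof
  define t where "t = Max (insert (- real a) (fst ` A))"
  have fin: "finite A" using assms(1) by (simp add: simple_on_def)
  hence t: "- real a \<le> t" "\<And>p. p \<in> A \<Longrightarrow> fst p \<le> t" by (auto simp: t_def)
  have "half_strip t (ordinate n (Suc j)) (ordinate n j)
      \<subseteq> half_strip (- real a) (ereal (- real a)) \<infinity>"
    using t(1) assms(2) by (intro half_strip_mono) auto
  hence "strip_count \<nu> n j t =
      of_nat (card {p \<in> A. plane_point p \<in> half_strip t (ordinate n (Suc j)) (ordinate n j)})"
    using assms(1) half_strip_sets unfolding simple_on_def by auto
  also have "{p \<in> A. plane_point p \<in> half_strip t (ordinate n (Suc j)) (ordinate n j)} = {}"
    using t(2) by (force simp: half_strip_def)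
  finally show "strip_count \<nu> n j t = 0" by simp
qed

lemma integral_simple_on:
  assumes sets: "sets \<nu> = sets (borel_of_top upper_plane)"
    and W: "simple_on \<nu> W A" "W \<in> sets \<nu>"
    and f: "continuous_map upper_plane euclideanreal f"
    and supp: "\<And>p. p \<in> topspace upper_plane \<Longrightarrow> p \<notin> W \<Longrightarrow> f p = 0"
  shows "(\<integral>p. f p \<partial>\<nu>) = (\<Sum>p\<in>A. f (plane_point p))"
proof -
  have A: "finite A" "plane_point ` A \<subseteq> W" using W(1) by (auto simp: simple_on_def)
  have count: "emeasure \<nu> B = of_nat (card {p \<in> A. plane_point p \<in> B})" if "B \<in> sets \<nu>" "B \<subseteq> W" for B
    using that W(1) sets unfolding simple_on_def by blast
  have inj: "inj_on plane_point A" by (auto simp: inj_on_def prod_eq_iff)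
  have W_sub: "W \<subseteq> topspace upper_plane"
    using sets.sets_into_space[OF W(2)] sets_eq_imp_space_eq[OF sets] by simp
  have point: "{plane_point p} \<in> sets \<nu>" "emeasure \<nu> {plane_point p} = 1" if "p \<in> A" for p
  proof -
    show *: "{plane_point p} \<in> sets \<nu>"
      unfolding sets by (rule sets_upper_planeI) auto
    have "{q \<in> A. plane_point q \<in> {plane_point p}} = {p}" using that by (auto simp: prod_eq_iff)
    moreover have "{plane_point p} \<subseteq> W" using that A(2) by blast
    ultimately show "emeasure \<nu> {plane_point p} = 1" using count[OF *] by simp
  qed
  have A_sets: "plane_point ` A \<in> sets \<nu>"
  proof -
    have "plane_point ` A = (\<Union>p\<in>A. {plane_point p})" by auto
    also have "\<dots> \<in> sets \<nu>" using point(1) A(1) by (intro sets.finite_UN) auto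
    finally show ?thesis .
  qed
  have null: "W - plane_point ` A \<in> null_sets \<nu>"
  proof -
    have "emeasure \<nu> (W - plane_point ` A) = of_nat (card {p \<in> A. plane_point p \<in> W - plane_point ` A})"
      by (rule count) (use W(2) A_sets in auto)
    also have "{p \<in> A. plane_point p \<in> W - plane_point ` A} = {}" by blast
    finally show ?thesis using W(2) A_sets by (auto intro!: null_setsI)
  qed
  have f_meas: "f \<in> borel_measurable \<nu>"
    using borel_measurable_of_continuous_map[OF f] sets by (simp cong: measurable_cong_sets)
  have "(\<integral>p. f p \<partial>\<nu>) = (\<integral>x. (\<Sum>p\<in>A. f (plane_point p) * indicator {plane_point p} x) \<partial>\<nu>)"
  proof (rule integral_cong_AE)
    show "AE x in \<nu>. f x = (\<Sum>p\<in>A. f (plane_point p) * indicator {plane_point p} x)"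
      using AE_not_in[OF null] AE_space
    proof eventually_elim
      case (elim x)
      show ?case
      proof (cases "x \<in> plane_point ` A")
        case True
        then obtain q where q: "q \<in> A" "x = plane_point q" by blast
        have "(\<Sum>p\<in>A. f (plane_point p) * indicator {plane_point p} x) =
            (\<Sum>p\<in>A. if p = q then f (plane_point q) else 0)"
          by (rule sum.cong) (use q in \<open>auto simp: indicator_def prod_eq_iff\<close>)
        thus ?thesis using q A(1) by simp
      next
        case False
        have "(\<Sum>p\<in>A. f (plane_point p) * indicator {plane_point p} x) = 0"
          by (rule sum.neutral) (use False in \<open>auto simp: indicator_def\<close>)
        moreover have "x \<notin> W" using False elim(1) by blast
        moreover have "x \<in> topspace upper_plane"
          using elim(2) sets_eq_imp_space_eq[OF sets] by simp
        ultimately show ?thesis using supp by simp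
      qed
    qed
  qed (use f_meas point in auto)
  also have "\<dots> = (\<Sum>p\<in>A. \<integral>x. f (plane_point p) * indicator {plane_point p} x \<partial>\<nu>)"
    by (rule Bochner_Integration.integral_sum) (use point in \<open>auto simp: integrable_real_mult_indicator\<close>)
  also have "\<dots> = (\<Sum>p\<in>A. f (plane_point p))"
    by (rule sum.cong) (use point in \<open>auto simp: measure_def\<close>)
  finally show ?thesis .
qed

text \<open>
  For large \<open>n\<close>, different points of \<open>\<nu>\<close> in a window lie in different strips, so there the strip
  maxima are exactly the abscissas of these points; all other strips have their maximum below the
  window, and the change of variables does not bring it back into the support of the test function.
\<close>

lemma process_of_strip_max_converges:
  assumes \<gamma>: "\<gamma> > 0" and radon: "\<nu> \<in> radon_measures upper_plane"
    and simple: "\<And>a::nat. \<exists>A. simple_on \<nu> (half_strip (- real a) (ereal (- real a)) \<infinity>) A"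
    and nonempty: "\<And>n j. n \<ge> 2 \<Longrightarrow> \<exists>t. strip_count \<nu> n j t \<noteq> 0"
  shows "limitin (vague_topology upper_plane)
    (\<lambda>n. process_of \<gamma> n (\<lambda>j. gumbel_to_exponential (strip_mass \<gamma> n j) (strip_max \<nu> n j))) \<nu> sequentially"
proof (rule limitin_vague_topologyI[OF radon])
  show "\<forall>\<^sub>F n in sequentially. process_of \<gamma> n (\<lambda>j. gumbel_to_exponential (strip_mass \<gamma> n j)
      (strip_max \<nu> n j)) \<in> radon_measures upper_plane"
    using eventually_ge_at_top[of 2] by eventually_elim (rule process_of_radon)
next
  have sets: "sets \<nu> = sets (borel_of_top upper_plane)"
    using radon by (simp add: radon_measures_def)
  have max_le_iff: "strip_max \<nu> n j \<le> t \<longleftrightarrow> strip_count \<nu> n j t = 0" if n: "n \<ge> 2" for n j t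
  proof -
    obtain a :: nat where "- ordinate n (Suc j) \<le> real a" using real_arch_simple by blast
    hence "\<exists>t. strip_count \<nu> n j t = 0"
      using simple[of a] simple_on_strip_empty[of \<nu> a _ n j] by auto
    thus ?thesis by (rule strip_max_le_iff[OF sets _ nonempty[OF n]])
  qed
  fix f assume "f \<in> cont_compact_support upper_plane"
  then obtain c where f: "continuous_map upper_plane euclideanreal f"
    and c: "\<And>x z. - \<infinity> < x \<Longrightarrow> - \<infinity> < z \<Longrightarrow> f (x, z) \<noteq> 0 \<Longrightarrow> ereal c \<le> x \<and> ereal c \<le> z"
    by (rule cont_compact_support_upper_plane) blast
  obtain x1 where x1: "\<And>z0. \<forall>\<^sub>F n in sequentially. \<forall>j t. ordinate n (Suc j) \<ge> z0 \<longrightarrow>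
      coupled_abscissa \<gamma> n j t \<ge> c \<longrightarrow> t \<ge> x1"
    using coupled_abscissa_lower_bound[OF \<gamma>, of c] by blast
  obtain a :: nat where "max (- c) (- x1) < real a" using reals_Archimedean2 by blast
  hence a: "- real a < c" "- real a < x1" by auto
  define W where "W = half_strip (- real a) (ereal (- real a)) \<infinity>"
  obtain A where A: "simple_on \<nu> W A" using simple unfolding W_def by blast
  have fin: "finite A" and inj_snd: "inj_on snd A" and A_W: "plane_point ` A \<subseteq> W"
    using A by (auto simp: simple_on_def)
  have A_gt: "- real a < fst p" "- real a < snd p" if "p \<in> A" for p
    using A_W that by (auto simp: W_def half_strip_def)
  have W_sets: "W \<in> sets \<nu>" unfolding sets W_def by (rule half_strip_sets)
  have int_\<nu>: "(\<integral>p. f p \<partial>\<nu>) = (\<Sum>p\<in>A. f (plane_point p))"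
  proof (rule integral_simple_on[OF sets A W_sets f], rule ccontr)
    fix p assume p: "p \<in> topspace upper_plane" "p \<notin> W" "f p \<noteq> 0"
    hence "ereal c \<le> fst p \<and> ereal c \<le> snd p"
      using c[of "fst p" "snd p"] by (auto simp: topspace_upper_plane)
    hence "ereal (- real a) < fst p" "ereal (- real a) < snd p"
      using a(1) by (auto intro: less_le_trans[of _ "ereal c"])
    thus False using p(2) by (cases p) (auto simp: W_def half_strip_def)
  qed
  have count: "strip_count \<nu> n j t =
      of_nat (card {p \<in> A. fst p > t \<and> ordinate n (Suc j) < snd p \<and> snd p \<le> ordinate n j})"
    if "- real a \<le> t" "- real a \<le> ordinate n (Suc j)" for n j t
  proof -
    have "half_strip t (ordinate n (Suc j)) (ordinate n j) \<subseteq> W"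
      using that unfolding W_def by (intro half_strip_mono) auto
    hence "strip_count \<nu> n j t =
        of_nat (card {p \<in> A. plane_point p \<in> half_strip t (ordinate n (Suc j)) (ordinate n j)})"
      using A half_strip_sets unfolding simple_on_def by auto
    thus ?thesis by (simp add: half_strip_def)
  qed

  have "\<exists>j. (\<forall>\<^sub>F n in sequentially. ordinate n (Suc (j n)) < z \<and> z \<le> ordinate n (j n)) \<and>
      (\<lambda>n. ordinate n (Suc (j n))) \<longlonglongrightarrow> z" for z
    using strip_index_exists[of z] by blast
  then obtain J where J: "\<And>z. \<forall>\<^sub>F n in sequentially. ordinate n (Suc (J z n)) < z \<and> z \<le> ordinate n (J z n)"
    "\<And>z. (\<lambda>n. ordinate n (Suc (J z n))) \<longlonglongrightarrow> z"
    by metis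
  have ev_J: "\<forall>\<^sub>F n in sequentially. \<forall>p\<in>A. ordinate n (Suc (J (snd p) n)) < snd p \<and>
      snd p \<le> ordinate n (J (snd p) n) \<and> - real a < ordinate n (Suc (J (snd p) n))"
  proof (intro eventually_ball_finite[OF fin] ballI)
    fix p assume "p \<in> A"
    show "\<forall>\<^sub>F n in sequentially. ordinate n (Suc (J (snd p) n)) < snd p \<and>
        snd p \<le> ordinate n (J (snd p) n) \<and> - real a < ordinate n (Suc (J (snd p) n))"
      using J(1)[of "snd p"] order_tendstoD(1)[OF J(2) A_gt(2)[OF \<open>p \<in> A\<close>]]
      by eventually_elim simp
  qed
  have ev_inj: "\<forall>\<^sub>F n in sequentially. \<forall>p\<in>A. \<forall>q\<in>A. p \<noteq> q \<longrightarrow> J (snd p) n \<noteq> J (snd q) n"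
  proof (intro eventually_ball_finite[OF fin] ballI)
    fix p q assume pq: "p \<in> A" "q \<in> A"
    show "\<forall>\<^sub>F n in sequentially. p \<noteq> q \<longrightarrow> J (snd p) n \<noteq> J (snd q) n"
    proof (cases "p = q")
      case False
      hence "snd p - snd q \<noteq> 0" using inj_on_eq_iff[OF inj_snd pq] by simp
      moreover have "(\<lambda>n. ordinate n (Suc (J (snd p) n)) - ordinate n (Suc (J (snd q) n)))
          \<longlonglongrightarrow> snd p - snd q"
        by (intro tendsto_intros J(2))
      ultimately have "\<forall>\<^sub>F n in sequentially.
          ordinate n (Suc (J (snd p) n)) - ordinate n (Suc (J (snd q) n)) \<noteq> 0"
        by (rule tendsto_imp_eventually_ne[rotated])
      thus ?thesis by (rule eventually_mono) auto
    qed simp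
  qed
  have "\<forall>\<^sub>F n in sequentially.
      (\<integral>p. f p \<partial>process_of \<gamma> n (\<lambda>j. gumbel_to_exponential (strip_mass \<gamma> n j) (strip_max \<nu> n j))) =
      (\<Sum>p\<in>A. f (plane_point (coupled_abscissa \<gamma> n (J (snd p) n) (fst p), ordinate n (Suc (J (snd p) n)))))"
    using eventually_ge_at_top[of 2] x1[of c] ev_J ev_inj
  proof eventually_elim
    case (elim n)
    have J_eq: "J (snd p) n = j" if "p \<in> A" "ordinate n (Suc j) < snd p" "snd p \<le> ordinate n j" for p j
      using strip_index_unique[OF elim(1), of "J (snd p) n" "snd p" j] elim(3) that by blast
    have max_eq: "strip_max \<nu> n (J (snd p) n) = fst p" if p: "p \<in> A" for p
    proof -
      let ?j = "J (snd p) n"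
      have count_0: "strip_count \<nu> n ?j t = 0 \<longleftrightarrow> fst p \<le> t" if t: "- real a \<le> t" for t
      proof -
        have "{q \<in> A. fst q > t \<and> ordinate n (Suc ?j) < snd q \<and> snd q \<le> ordinate n ?j} =
            {q. q = p \<and> fst p > t}" (is "?L = ?R")
        proof (intro equalityI subsetI)
          fix q assume q: "q \<in> ?L"
          hence "J (snd q) n = ?j" using J_eq[of q ?j] by simp
          hence "q = p" using elim(4) p q by auto
          thus "q \<in> ?R" using q by simp
        next
          fix q assume "q \<in> ?R"
          thus "q \<in> ?L" using elim(3) p by auto
        qed
        hence "strip_count \<nu> n ?j t = of_nat (card {q. q = p \<and> fst p > t})"
          using count[OF t, of n ?j] elim(3) p by auto
        thus ?thesis by (cases "fst p > t") auto
      qed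
      have le: "strip_max \<nu> n ?j \<le> fst p"
        using max_le_iff[OF elim(1)] count_0[of "fst p"] A_gt(1)[OF p] by simp
      have "fst p \<le> max (- real a) (strip_max \<nu> n ?j)"
        using max_le_iff[OF elim(1), of ?j "max (- real a) (strip_max \<nu> n ?j)"]
          count_0[of "max (- real a) (strip_max \<nu> n ?j)"] by simp
      with le A_gt(1)[OF p] show ?thesis by simp
    qed
    have inj: "inj_on (\<lambda>p. J (snd p) n) A"
      using elim(4) by (auto simp: inj_on_def)
    have "(\<integral>p. f p \<partial>process_of \<gamma> n (\<lambda>j. gumbel_to_exponential (strip_mass \<gamma> n j) (strip_max \<nu> n j))) =
      (\<Sum>j\<in>(\<lambda>p. J (snd p) n) ` A.
        f (ereal (coupled_abscissa \<gamma> n j (strip_max \<nu> n j)), ereal (ordinate n (Suc j))))"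
    proof (rule integral_process_of[OF f], goal_cases)
      case 1
      show ?case using fin by simp
    next
      case (2 j)
      show ?case
      proof (rule ccontr)
        assume "f (ereal (coupled_abscissa \<gamma> n j (strip_max \<nu> n j)), ereal (ordinate n (Suc j))) \<noteq> 0"
        hence ge: "c \<le> coupled_abscissa \<gamma> n j (strip_max \<nu> n j)" "c \<le> ordinate n (Suc j)"
          using c[of "ereal (coupled_abscissa \<gamma> n j (strip_max \<nu> n j))"
            "ereal (ordinate n (Suc j))"] by auto
        hence "x1 \<le> strip_max \<nu> n j" using elim(2) by blast
        hence "strip_count \<nu> n j (- real a) \<noteq> 0"
          using max_le_iff[OF elim(1), of j "- real a"] a(2) by simp
        hence "card {p \<in> A. fst p > - real a \<and> ordinate n (Suc j) < snd p \<and> snd p \<le> ordinate n j} \<noteq> 0"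
          using count[of "- real a" n j] ge(2) a(1) by simp
        hence "{p \<in> A. fst p > - real a \<and> ordinate n (Suc j) < snd p \<and> snd p \<le> ordinate n j} \<noteq> {}"
          by (metis card.empty)
        then obtain p where "p \<in> A" "J (snd p) n = j" using J_eq by auto
        thus False using 2 by auto
      qed
    qed
    also have "\<dots> = (\<Sum>p\<in>A. f (ereal (coupled_abscissa \<gamma> n (J (snd p) n) (strip_max \<nu> n (J (snd p) n))),
        ereal (ordinate n (Suc (J (snd p) n)))))"
      by (subst sum.reindex[OF inj]) simp
    also have "\<dots> = (\<Sum>p\<in>A. f (plane_point (coupled_abscissa \<gamma> n (J (snd p) n) (fst p),
        ordinate n (Suc (J (snd p) n)))))"
      by (rule sum.cong) (simp_all add: max_eq)
    finally show ?case .
  qed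
  moreover have "(\<lambda>n. \<Sum>p\<in>A. f (plane_point (coupled_abscissa \<gamma> n (J (snd p) n) (fst p),
      ordinate n (Suc (J (snd p) n))))) \<longlonglongrightarrow> (\<Sum>p\<in>A. f (plane_point p))"
  proof (rule tendsto_sum)
    fix p assume "p \<in> A"
    have "(\<lambda>n. (coupled_abscissa \<gamma> n (J (snd p) n) (fst p), ordinate n (Suc (J (snd p) n))))
        \<longlonglongrightarrow> (fst p, snd p)"
      by (intro tendsto_Pair coupled_abscissa_tendsto[OF \<gamma> J(2)] J(2))
    moreover have "isCont (\<lambda>p. f (plane_point p)) (fst p, snd p)"
      using continuous_map_upper_plane_real[OF f] by (simp add: continuous_on_eq_continuous_at del: split_paired_All)
    ultimately show "(\<lambda>n. f (plane_point (coupled_abscissa \<gamma> n (J (snd p) n) (fst p),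
        ordinate n (Suc (J (snd p) n))))) \<longlonglongrightarrow> f (plane_point p)"
      using isCont_tendsto_compose by fastforce
  qed
  ultimately show "(\<lambda>n. \<integral>p. f p \<partial>process_of \<gamma> n (\<lambda>j. gumbel_to_exponential (strip_mass \<gamma> n j)
      (strip_max \<nu> n j))) \<longlonglongrightarrow> (\<integral>p. f p \<partial>\<nu>)"
    by (simp add: int_\<nu> tendsto_cong)
qed

section \<open>The law of the coupled process\<close>

lemma (in prob_space) indep_vars_reindex_inj:
  assumes X: "indep_vars M' X I" and h: "inj_on h K" "h ` K \<subseteq> I"
  shows "indep_vars (\<lambda>k. M' (h k)) (\<lambda>k. X (h k)) K"
  unfolding indep_vars_def2
proof (intro conjI ballI)
  let ?F = "\<lambda>i. {X i -` A \<inter> space M | A. A \<in> sets (M' i)}"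
  have rv: "random_variable (M' i) (X i)" if "i \<in> I" for i
    using X that by (simp add: indep_vars_def2)
  have F: "indep_sets ?F I" using X by (simp add: indep_vars_def2)
  show "random_variable (M' (h k)) (X (h k))" if "k \<in> K" for k
    using rv that h(2) by blast
  show "indep_sets (\<lambda>k. ?F (h k)) K"
  proof (rule indep_setsI)
    show "?F (h k) \<subseteq> events" if "k \<in> K" for k
      using F that h(2) by (auto simp: indep_sets_def)
  next
    fix A J assume J: "J \<noteq> {}" "J \<subseteq> K" "finite J" and A: "\<forall>j\<in>J. A j \<in> ?F (h j)"
    define A' where "A' i = A (the_inv_into J h i)" for i
    have inj: "inj_on h J" using h(1) J(2) by (rule inj_on_subset)
    have A': "A' (h j) = A j" if "j \<in> J" for j
      using the_inv_into_f_f[OF inj that] by (simp add: A'_def)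
    have "prob (\<Inter>i\<in>h ` J. A' i) = (\<Prod>i\<in>h ` J. prob (A' i))"
      by (rule indep_setsD[OF F]) (use J h(2) A A' in auto)
    thus "prob (\<Inter>j\<in>J. A j) = (\<Prod>j\<in>J. prob (A j))"
      using A' by (simp add: prod.reindex[OF inj] cong: prod.cong)
  qed
qed

lemma (in prob_space) distr_indep_exponential:
  fixes Y :: "nat \<Rightarrow> 'a \<Rightarrow> real"
  assumes "indep_vars (\<lambda>_. borel) Y UNIV"
    and Y: "\<And>j. distributed M lborel (Y j) (exponential_density 1)"
  shows "distr M (\<Pi>\<^sub>M j\<in>UNIV. borel) (\<lambda>\<omega> j. Y j \<omega>) =
    (\<Pi>\<^sub>M j\<in>UNIV. density lborel (\<lambda>x. ennreal (exponential_density 1 x)))"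
proof -
  have rv: "random_variable borel (Y j)" for j
    using distributed_measurable[OF Y[of j]] by simp
  have law: "distr M borel (Y j) = density lborel (\<lambda>x. ennreal (exponential_density 1 x))" for j
  proof -
    have "distr M borel (Y j) = distr M lborel (Y j)" by (rule distr_cong) auto
    thus ?thesis using distributed_distr_eq_density[OF Y[of j]] by simp
  qed
  have "distr M (\<Pi>\<^sub>M j\<in>UNIV. borel) (\<lambda>\<omega>. \<lambda>j\<in>UNIV. Y j \<omega>) = (\<Pi>\<^sub>M j\<in>UNIV. distr M borel (Y j))"
    using indep_vars_iff_distr_eq_PiM[where I = UNIV and M' = "\<lambda>_. borel" and X = Y] rv assms(1) by auto
  thus ?thesis by (simp add: law restrict_UNIV)
qed

text \<open>
  The closed lower half lines form an intersection-stable generator of the Borel sets, so a product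
  formula for joint distribution functions is enough.
\<close>

lemma (in prob_space) indep_vars_of_cdf:
  fixes G :: "'i \<Rightarrow> 'a \<Rightarrow> real"
  assumes rv: "\<And>i. i \<in> I \<Longrightarrow> random_variable borel (G i)"
    and prod: "\<And>J t. J \<noteq> {} \<Longrightarrow> J \<subseteq> I \<Longrightarrow> finite J \<Longrightarrow>
      prob {\<omega> \<in> space M. \<forall>i\<in>J. G i \<omega> \<le> t i} = (\<Prod>i\<in>J. prob {\<omega> \<in> space M. G i \<omega> \<le> t i})"
  shows "indep_vars (\<lambda>_. borel) G I"
proof -
  define F where "F i = {G i -` A \<inter> space M | A. A \<in> range (\<lambda>t::real. {..t})}" for i
  have sets_borel: "sets (borel :: real measure) = sigma_sets UNIV (range (\<lambda>t::real. {..t}))"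
    by (subst borel_eq_atMost) simp
  have gen: "sigma_sets (space M) {G i -` A \<inter> space M | A. A \<in> sets borel} =
      sigma_sets (space M) (F i)" if "i \<in> I" for i
  proof -
    have "{G i -` A \<inter> space M | A. A \<in> sets borel} = sigma_sets (space M) (F i)"
      unfolding sets_borel F_def by (rule sigma_sets_vimage_commute) simp
    moreover have "F i \<subseteq> Pow (space M)" by (auto simp: F_def)
    ultimately show ?thesis by (simp only: sigma_sets_sigma_sets_eq)
  qed
  have "indep_sets F I"
  proof (rule indep_setsI)
    show "F i \<subseteq> events" if "i \<in> I" for i
      using rv[OF that] by (auto simp: F_def intro!: measurable_sets[of _ _ borel])
  next
    fix A J assume J: "J \<noteq> {}" "J \<subseteq> I" "finite J" and A: "\<forall>j\<in>J. A j \<in> F j"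
    have "\<exists>t. A j = {\<omega> \<in> space M. G j \<omega> \<le> t}" if j: "j \<in> J" for j
    proof -
      obtain t where "A j = G j -` {..t} \<inter> space M" using A j by (auto simp: F_def)
      thus ?thesis by (intro exI[of _ t]) auto
    qed
    then obtain t where t: "\<And>j. j \<in> J \<Longrightarrow> A j = {\<omega> \<in> space M. G j \<omega> \<le> t j}" by metis
    hence "(\<Inter>j\<in>J. A j) = {\<omega> \<in> space M. \<forall>i\<in>J. G i \<omega> \<le> t i}" using J(1) by auto
    thus "prob (\<Inter>j\<in>J. A j) = (\<Prod>j\<in>J. prob (A j))"
      using prod[OF J, of t] t by (simp cong: prod.cong)
  qed
  hence "indep_sets (\<lambda>i. sigma_sets (space M) (F i)) I"
  proof (rule indep_sets_sigma)
    fix i assume "i \<in> I"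
    show "Int_stable (F i)"
    proof (rule Int_stableI)
      fix a b assume "a \<in> F i" "b \<in> F i"
      then obtain s t where "a = G i -` {..s} \<inter> space M" "b = G i -` {..t} \<inter> space M"
        by (auto simp: F_def)
      hence "a \<inter> b = G i -` {..min s t} \<inter> space M" by auto
      thus "a \<inter> b \<in> F i" by (auto simp: F_def)
    qed
  qed
  thus ?thesis
    unfolding indep_vars_def using rv gen by (auto cong: indep_sets_cong)
qed

lemma gumbel_to_exponential_le_iff:
  assumes "w > 0" "u > 0"
  shows "gumbel_to_exponential w t \<le> u \<longleftrightarrow> t \<le> ln w - ln (- ln (1 - exp (- u)))"
proof -
  have v: "w * exp (- t) > 0" using assms by simp
  have q: "0 < 1 - exp (- u)" "1 - exp (- u) < 1" using assms by auto
  hence l: "- ln (1 - exp (- u)) > 0" by simp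
  have "gumbel_to_exponential w t \<le> u \<longleftrightarrow> - u \<le> ln (1 - exp (- (w * exp (- t))))"
    by (auto simp: gumbel_to_exponential_def)
  also have "\<dots> \<longleftrightarrow> exp (- u) \<le> 1 - exp (- (w * exp (- t)))"
    using v by (subst ln_ge_iff) auto
  also have "\<dots> \<longleftrightarrow> exp (- (w * exp (- t))) \<le> 1 - exp (- u)" by linarith
  also have "\<dots> \<longleftrightarrow> - (w * exp (- t)) \<le> ln (1 - exp (- u))"
    using q(1) by (rule ln_ge_iff[symmetric])
  also have "\<dots> \<longleftrightarrow> - ln (1 - exp (- u)) \<le> exp (ln w - t)"
    using assms(1) by (auto simp: exp_diff exp_minus field_simps)
  also have "\<dots> \<longleftrightarrow> ln (- ln (1 - exp (- u))) \<le> ln w - t"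
    using l by (subst ln_le_cancel_iff[symmetric]) auto
  also have "\<dots> \<longleftrightarrow> t \<le> ln w - ln (- ln (1 - exp (- u)))" by linarith
  finally show ?thesis .
qed

context poisson_on_plane
begin

lemma strip_sets [measurable]:
  "half_strip t (ordinate n (Suc j)) (ordinate n j) \<in> sets (borel_of_top upper_plane)"
  by (rule half_strip_sets)

lemma AE_strip_max_le_iff:
  assumes "n \<ge> 2"
  shows "AE \<omega> in N. \<forall>j t. strip_max (\<xi> \<omega>) n j \<le> t \<longleftrightarrow> strip_count (\<xi> \<omega>) n j t = 0"
  using AE_simple AE_strips_nonempty AE_space
proof eventually_elim
  case (elim \<omega>)
  show ?case
  proof (intro allI)
    fix j t
    obtain a :: nat where "- ordinate n (Suc j) \<le> real a" using real_arch_simple by blast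
    hence "\<exists>t. strip_count (\<xi> \<omega>) n j t = 0"
      using elim(1) simple_on_strip_empty[of "\<xi> \<omega>" a _ n j] by auto
    thus "strip_max (\<xi> \<omega>) n j \<le> t \<longleftrightarrow> strip_count (\<xi> \<omega>) n j t = 0"
      using elim(2) assms by (intro strip_max_le_iff[OF sets_xi[OF elim(3)]]) auto
  qed
qed

text \<open>
  By monotonicity of the counts, integer levels decide which branch of the definition applies.
\<close>

lemma measurable_strip_max: "(\<lambda>\<omega>. strip_max (\<xi> \<omega>) n j) \<in> borel_measurable N"
proof (rule borel_measurableI_le)
  fix t :: real
  have "{\<omega> \<in> space N. strip_max (\<xi> \<omega>) n j \<le> t} = {\<omega> \<in> space N.
      if (\<exists>k::nat. strip_count (\<xi> \<omega>) n j (real k) = 0) \<and>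
         (\<exists>k::nat. strip_count (\<xi> \<omega>) n j (- real k) \<noteq> 0)
      then strip_count (\<xi> \<omega>) n j t = 0 else 0 \<le> t}"
  proof (rule Collect_cong, rule conj_cong[OF refl])
    fix \<omega> assume \<omega>: "\<omega> \<in> space N"
    have 1: "(\<exists>k::nat. strip_count (\<xi> \<omega>) n j (real k) = 0) \<longleftrightarrow> (\<exists>t. strip_count (\<xi> \<omega>) n j t = 0)"
      using strip_count_eq_0_mono[OF sets_xi[OF \<omega>]] real_arch_simple by metis
    have "\<exists>k::nat. - real k \<le> s" for s
      using real_arch_simple[of "- s"] by (auto simp: minus_le_iff)
    hence 2: "(\<exists>k::nat. strip_count (\<xi> \<omega>) n j (- real k) \<noteq> 0) \<longleftrightarrow> (\<exists>t. strip_count (\<xi> \<omega>) n j t \<noteq> 0)"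
      using strip_count_eq_0_mono[OF sets_xi[OF \<omega>]] by metis
    show "strip_max (\<xi> \<omega>) n j \<le> t \<longleftrightarrow>
      (if (\<exists>k::nat. strip_count (\<xi> \<omega>) n j (real k) = 0) \<and>
         (\<exists>k::nat. strip_count (\<xi> \<omega>) n j (- real k) \<noteq> 0)
      then strip_count (\<xi> \<omega>) n j t = 0 else 0 \<le> t)"
      unfolding 1 2 using strip_max_le_iff[OF sets_xi[OF \<omega>], of n j t]
      by (auto simp: strip_max_def)
  qed
  also have "\<dots> \<in> events" by measurable
  finally show "{\<omega> \<in> space N. strip_max (\<xi> \<omega>) n j \<le> t} \<in> events" .
qed

text \<open>A maximum at most \<open>t\<close> is a void event, so its Poisson probability is of Gumbel type.\<close>

lemma prob_strip_max_le:
  assumes n: "n \<ge> 2"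
  shows "prob {\<omega> \<in> space N. strip_max (\<xi> \<omega>) n j \<le> t} = exp (- (strip_mass \<gamma> n j * exp (- t)))"
proof -
  have "prob {\<omega> \<in> space N. strip_max (\<xi> \<omega>) n j \<le> t} =
      prob {\<omega> \<in> space N. strip_count (\<xi> \<omega>) n j t = 0}"
  proof (rule finite_measure_eq_AE)
    show "AE \<omega> in N. \<omega> \<in> {\<omega> \<in> space N. strip_max (\<xi> \<omega>) n j \<le> t} \<longleftrightarrow>
        \<omega> \<in> {\<omega> \<in> space N. strip_count (\<xi> \<omega>) n j t = 0}"
      using AE_strip_max_le_iff[OF n] by eventually_elim simp
  qed (use measurable_strip_max in measurable)
  also have "\<dots> = exp (- (exp (- t) * strip_mass \<gamma> n j))"
  proof (rule prob_count_0[OF strip_sets])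
    have "ordinate n (Suc j) \<le> ordinate n j"
      using ordinate_less[OF n, of j "Suc j"] by simp
    from half_strip_mean[OF this, of t]
    show "emeasure (mu_hat \<gamma>) (half_strip t (ordinate n (Suc j)) (ordinate n j)) =
        ennreal (exp (- t) * strip_mass \<gamma> n j)" "0 \<le> exp (- t) * strip_mass \<gamma> n j"
      by (simp_all add: strip_mass_def)
  qed
  finally show ?thesis by (simp add: mult.commute)
qed

text \<open>The strips are disjoint, and each maximum is determined by the void events of its own strip.\<close>

lemma indep_strip_max:
  assumes n: "n \<ge> 2"
  shows "indep_vars (\<lambda>_. borel) (\<lambda>j \<omega>. strip_max (\<xi> \<omega>) n j) UNIV"
proof (rule indep_vars_of_cdf)
  show "random_variable borel (\<lambda>\<omega>. strip_max (\<xi> \<omega>) n j)" for j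
    by (rule measurable_strip_max)
next
  fix J :: "nat set" and t
  assume J: "J \<noteq> {}" "finite J"
  define m where "m = Suc (Max J)"
  define B where "B j = half_strip (t j) (ordinate n (Suc j)) (ordinate n j)" for j
  have sub: "J \<subseteq> {..<m}" using Max_ge[OF J(2)] by (auto simp: m_def less_Suc_eq_le)
  have "disjoint_family_on B {..<m}"
    unfolding disjoint_family_on_def
  proof (intro ballI impI, rule ccontr)
    fix i j assume "i \<noteq> j" "B i \<inter> B j \<noteq> {}"
    then obtain z where z: "ereal (ordinate n (Suc i)) < z" "z \<le> ereal (ordinate n i)"
      "ereal (ordinate n (Suc j)) < z" "z \<le> ereal (ordinate n j)"
      by (auto simp: B_def half_strip_def)
    then obtain r where "z = ereal r" by (cases z) auto
    thus False using strip_index_unique[OF n, of i r j] z \<open>i \<noteq> j\<close> by simp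
  qed
  hence "indep_vars (\<lambda>_. borel) (\<lambda>j \<omega>. emeasure (\<xi> \<omega>) (B j)) {..<m}"
    by (rule indep_counts[rotated]) (simp add: B_def)
  hence "prob (\<Inter>j\<in>J. (\<lambda>\<omega>. emeasure (\<xi> \<omega>) (B j)) -` {0} \<inter> space N) =
      (\<Prod>j\<in>J. prob ((\<lambda>\<omega>. emeasure (\<xi> \<omega>) (B j)) -` {0} \<inter> space N))"
    by (rule indep_varsD) (use J sub in auto)
  moreover have "prob {\<omega> \<in> space N. \<forall>j\<in>J. strip_max (\<xi> \<omega>) n j \<le> t j} =
      prob (\<Inter>j\<in>J. (\<lambda>\<omega>. emeasure (\<xi> \<omega>) (B j)) -` {0} \<inter> space N)"
  proof (rule finite_measure_eq_AE)
    show "AE \<omega> in N. \<omega> \<in> {\<omega> \<in> space N. \<forall>j\<in>J. strip_max (\<xi> \<omega>) n j \<le> t j} \<longleftrightarrow>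
        \<omega> \<in> (\<Inter>j\<in>J. (\<lambda>\<omega>. emeasure (\<xi> \<omega>) (B j)) -` {0} \<inter> space N)"
      using AE_strip_max_le_iff[OF n] AE_space by eventually_elim (use J in \<open>auto simp: B_def\<close>)
    show "(\<Inter>j\<in>J. (\<lambda>\<omega>. emeasure (\<xi> \<omega>) (B j)) -` {0} \<inter> space N) \<in> events"
      using J by (intro sets.finite_INT measurable_sets[OF measurable_count]) (auto simp: B_def)
    show "{\<omega> \<in> space N. \<forall>j\<in>J. strip_max (\<xi> \<omega>) n j \<le> t j} \<in> events"
      using J(2) measurable_strip_max by measurable
  qed
  moreover have "prob {\<omega> \<in> space N. strip_max (\<xi> \<omega>) n j \<le> t j} =
      prob ((\<lambda>\<omega>. emeasure (\<xi> \<omega>) (B j)) -` {0} \<inter> space N)" for j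
  proof (rule finite_measure_eq_AE)
    show "AE \<omega> in N. \<omega> \<in> {\<omega> \<in> space N. strip_max (\<xi> \<omega>) n j \<le> t j} \<longleftrightarrow>
        \<omega> \<in> (\<lambda>\<omega>. emeasure (\<xi> \<omega>) (B j)) -` {0} \<inter> space N"
      using AE_strip_max_le_iff[OF n] AE_space by eventually_elim (auto simp: B_def)
    show "(\<lambda>\<omega>. emeasure (\<xi> \<omega>) (B j)) -` {0} \<inter> space N \<in> events"
      by (intro measurable_sets[OF measurable_count]) (auto simp: B_def)
    show "{\<omega> \<in> space N. strip_max (\<xi> \<omega>) n j \<le> t j} \<in> events"
      using measurable_strip_max by measurable
  qed
  ultimately show "prob {\<omega> \<in> space N. \<forall>j\<in>J. strip_max (\<xi> \<omega>) n j \<le> t j} =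
      (\<Prod>j\<in>J. prob {\<omega> \<in> space N. strip_max (\<xi> \<omega>) n j \<le> t j})"
    by simp
qed

abbreviation coupled_exponential :: "nat \<Rightarrow> nat \<Rightarrow> 'v \<Rightarrow> real" where
  "coupled_exponential n j \<omega> \<equiv> gumbel_to_exponential (strip_mass \<gamma> n j) (strip_max (\<xi> \<omega>) n j)"

lemma measurable_gumbel_to_exponential [measurable]: "gumbel_to_exponential w \<in> borel_measurable borel"
  unfolding gumbel_to_exponential_def by measurable

lemma indep_coupled_exponential:
  "n \<ge> 2 \<Longrightarrow> indep_vars (\<lambda>_. borel) (coupled_exponential n) UNIV"
  by (rule indep_vars_compose2[OF indep_strip_max]) auto

lemma distributed_coupled_exponential:
  assumes n: "n \<ge> 2"
  shows "distributed N lborel (coupled_exponential n j) (exponential_density 1)"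
proof (subst exponential_distributed_iff, simp, intro conjI allI impI)
  define w where "w = strip_mass \<gamma> n j"
  have w: "w > 0" using strip_mass_pos[OF \<gamma> n] by (simp add: w_def)
  show "coupled_exponential n j \<in> borel_measurable N"
    by (rule measurable_compose[OF measurable_strip_max measurable_gumbel_to_exponential])
  fix u :: real assume u: "0 \<le> u"
  show "\<P>(\<omega> in N. coupled_exponential n j \<omega> \<le> u) = 1 - exp (- u * 1)"
  proof (cases "u = 0")
    case True
    have "gumbel_to_exponential w s > 0" for s
      using w by (simp add: gumbel_to_exponential_def)
    hence "{\<omega> \<in> space N. coupled_exponential n j \<omega> \<le> u} = {}"
      using True by (auto simp: not_le w_def)
    hence "\<P>(\<omega> in N. coupled_exponential n j \<omega> \<le> u) = 0" by (simp only: measure_empty)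
    thus ?thesis using True by simp
  next
    case False
    hence u: "u > 0" using u by simp
    have q: "0 < 1 - exp (- u)" "1 - exp (- u) < 1" using u by auto
    have "\<P>(\<omega> in N. coupled_exponential n j \<omega> \<le> u) =
        exp (- (w * exp (- (ln w - ln (- ln (1 - exp (- u)))))))"
      using prob_strip_max_le[OF n, of j "ln w - ln (- ln (1 - exp (- u)))"]
        gumbel_to_exponential_le_iff[OF w u] by (simp add: w_def)
    also have "w * exp (- (ln w - ln (- ln (1 - exp (- u))))) = - ln (1 - exp (- u))"
      using w q by (simp add: exp_diff)
    finally show ?thesis using q by simp
  qed
qed

lemma AE_coupled_process_converges:
  "AE \<omega> in N. limitin (vague_topology upper_plane)
     (\<lambda>n. process_of \<gamma> n (\<lambda>j. coupled_exponential n j \<omega>)) (\<xi> \<omega>) sequentially"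
  using AE_simple AE_strips_nonempty AE_space
proof eventually_elim
  case (elim \<omega>)
  show ?case
    by (rule process_of_strip_max_converges[OF \<gamma> xi_radon[OF elim(3)]]) (use elim in auto)
qed

end

section \<open>Convergence in distribution\<close>

theorem proposition2p3:
  fixes \<gamma> :: real
    and M :: "'w measure" and X :: "nat \<Rightarrow> 'w \<Rightarrow> real"
    and N :: "'v measure" and \<xi> :: "'v \<Rightarrow> (ereal \<times> ereal) measure"
  assumes "\<gamma> > 0"
    and "prob_space M"
    and "prob_space.indep_vars M (\<lambda>_. borel) X {1..}"
    and "\<And>i. i \<ge> 1 \<Longrightarrow> distributed M lborel (X i) (exponential_density 1)"
    and "prob_space N"
    and "poisson_point_process upper_plane (mu_hat \<gamma>) N \<xi>"
  shows "converges_in_distribution (vague_topology upper_plane) M (xi_hat \<gamma> X) N \<xi>"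
proof -
  interpret M: prob_space M by fact
  interpret poisson_on_plane N \<gamma> \<xi>
    by (intro poisson_on_plane.intro poisson_on_plane_axioms.intro assms)
  let ?V = "vague_topology upper_plane"
  let ?P = "\<Pi>\<^sub>M j\<in>(UNIV::nat set). (borel :: real measure)"
  define X' where "X' \<omega> = (\<lambda>j. X (Suc j) \<omega>)" for \<omega>
  have exp_X: "distributed M lborel (X (Suc j)) (exponential_density 1)" for j
    using assms(4) by simp
  have X'_meas: "X' \<in> measurable M ?P"
    unfolding X'_def using distributed_measurable[OF exp_X]
    by (intro measurable_PiM_single') auto
  have Y_meas: "(\<lambda>\<omega> j. coupled_exponential n j \<omega>) \<in> measurable N ?P" for n
    using measurable_compose[OF measurable_strip_max measurable_gumbel_to_exponential]
    by (intro measurable_PiM_single') auto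
  have "M.indep_vars (\<lambda>_. borel) (\<lambda>j. X (Suc j)) UNIV"
  proof (rule M.indep_vars_reindex_inj[OF assms(3), of Suc UNIV])
    show "inj_on Suc UNIV" by simp
    show "range Suc \<subseteq> {1..}" by auto
  qed
  hence law: "distr M ?P X' = distr N ?P (\<lambda>\<omega> j. coupled_exponential n j \<omega>)" if "n \<ge> 2" for n
    unfolding X'_def
    using M.distr_indep_exponential[OF _ exp_X]
      distr_indep_exponential[OF indep_coupled_exponential distributed_coupled_exponential, OF that that]
    by simp
  have process_meas: "process_of \<gamma> n \<in> measurable ?P (borel_of_top ?V)" if "n \<ge> 2" for n
  proof -
    have "process_of \<gamma> n \<in> measurable borel (borel_of_top ?V)"
      unfolding borel_of_top_def
    proof (rule measurable_measure_of)
      fix U assume "U \<in> {U. openin ?V U}"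
      hence "open (process_of \<gamma> n -` U)"
        using openin_continuous_map_preimage[OF continuous_map_process_of[OF that, of \<gamma>], of U]
        by (simp add: vimage_def)
      thus "process_of \<gamma> n -` U \<inter> space borel \<in> sets borel" by simp
    qed (use process_of_radon[OF that] openin_subset[of ?V] in \<open>force+\<close>)
    thus ?thesis by (simp add: sets_PiM_equal_borel cong: measurable_cong_sets)
  qed
  have "random_element M ?V (xi_hat \<gamma> X n)" if "n \<ge> 2" for n
    using measurable_compose[OF X'_meas process_meas[OF that]]
    by (simp add: random_element_def xi_hat_eq_process_of X'_def cong: measurable_cong)
  moreover have "(\<lambda>n. \<integral>\<omega>. F (xi_hat \<gamma> X n \<omega>) \<partial>M) \<longlonglongrightarrow> (\<integral>\<omega>. F (\<xi> \<omega>) \<partial>N)"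
    if F: "continuous_map ?V euclideanreal F" "bounded (F ` topspace ?V)" for F
  proof -
    have F_meas: "F \<in> borel_measurable (borel_of_top ?V)"
      by (rule borel_measurable_of_continuous_map[OF F(1)])
    obtain b where b: "\<And>\<mu>. \<mu> \<in> radon_measures upper_plane \<Longrightarrow> \<bar>F \<mu>\<bar> \<le> b"
      using F(2) by (auto simp: bounded_iff)
    have same: "(\<integral>\<omega>. F (xi_hat \<gamma> X n \<omega>) \<partial>M) =
        (\<integral>\<omega>. F (process_of \<gamma> n (\<lambda>j. coupled_exponential n j \<omega>)) \<partial>N)" if n: "n \<ge> 2" for n
    proof -
      have H: "(\<lambda>y. F (process_of \<gamma> n y)) \<in> borel_measurable ?P"
        by (rule measurable_compose[OF process_meas[OF n] F_meas])
      have "(\<integral>\<omega>. F (xi_hat \<gamma> X n \<omega>) \<partial>M) = (\<integral>y. F (process_of \<gamma> n y) \<partial>distr M ?P X')"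
        by (subst integral_distr[OF X'_meas H]) (simp add: xi_hat_eq_process_of X'_def)
      also have "\<dots> = (\<integral>\<omega>. F (process_of \<gamma> n (\<lambda>j. coupled_exponential n j \<omega>)) \<partial>N)"
        unfolding law[OF n] by (rule integral_distr[OF Y_meas H])
      finally show ?thesis .
    qed
    have "(\<lambda>n. \<integral>\<omega>. F (process_of \<gamma> (n + 2) (\<lambda>j. coupled_exponential (n + 2) j \<omega>)) \<partial>N)
        \<longlonglongrightarrow> (\<integral>\<omega>. F (\<xi> \<omega>) \<partial>N)"
    proof (rule integral_dominated_convergence[where w = "\<lambda>_. b"])
      show "(\<lambda>\<omega>. F (\<xi> \<omega>)) \<in> borel_measurable N"
        by (rule measurable_compose[OF random_element_xi[unfolded random_element_def] F_meas])
      show "(\<lambda>\<omega>. F (process_of \<gamma> (n + 2) (\<lambda>j. coupled_exponential (n + 2) j \<omega>))) \<in> borel_measurable N"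
        for n
        by (rule measurable_compose[OF measurable_compose[OF Y_meas process_meas] F_meas]) simp
      show "AE \<omega> in N. (\<lambda>n. F (process_of \<gamma> (n + 2) (\<lambda>j. coupled_exponential (n + 2) j \<omega>)))
          \<longlonglongrightarrow> F (\<xi> \<omega>)"
        using AE_coupled_process_converges
      proof eventually_elim
        case (elim \<omega>)
        have "(\<lambda>n. F (process_of \<gamma> n (\<lambda>j. coupled_exponential n j \<omega>))) \<longlonglongrightarrow> F (\<xi> \<omega>)"
          using continuous_map_limit[OF F(1) elim] by (simp add: o_def)
        thus ?case by (rule LIMSEQ_ignore_initial_segment)
      qed
      show "AE \<omega> in N. norm (F (process_of \<gamma> (n + 2) (\<lambda>j. coupled_exponential (n + 2) j \<omega>))) \<le> b" for n
        using b process_of_radon[of "n + 2"] by (intro AE_I2) auto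
    qed simp
    hence "(\<lambda>n. \<integral>\<omega>. F (xi_hat \<gamma> X (n + 2) \<omega>) \<partial>M) \<longlonglongrightarrow> (\<integral>\<omega>. F (\<xi> \<omega>) \<partial>N)"
      using same by simp
    thus ?thesis by (rule LIMSEQ_offset)
  qed
  ultimately show ?thesis
    unfolding converges_in_distribution_def using random_element_xi
    by (auto intro: eventually_sequentiallyI[of 2])
qed

end
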